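(* Let $n\ge 6$ and $n-1<m<2(n-2)$. Then the difference graph with vertex-eigenvector $(1,1;\,m-n+2,\,2n-4-m)$ is the unique (up to isomorphism) bipartite optimal graph in $\mathfrak{B}_{n,m}$.
   Context: All graphs are finite, simple and undirected. For a graph $G$ on $n$ vertices with adjacency matrix $\mathbf{A}(G)$, write $\det(\lambda I-\mathbf{A}(G))=\sum_{i=0}^n \mathbf{a}_i(G)\lambda^{n-i}$, so $\mathbf{a}_4(G)$ is the coefficient of $\lambda^{n-4}$. $\mathfrak{B}_{n,m}$ is the set of connected bipartite graphs with $n$ vertices and $m$ edges; $G\in\mathfrak{B}_{n,m}$ is bipartite optimal if $\mathbf{a}_4(G)=\min\{\mathbf{a}_4(H):H\in\mathfrak{B}_{n,m}\}$. A difference graph with vertex-eigenvector $(x_1,\ldots,x_k;y_1,\ldots,y_k)$ (positive integers) is the graph whose vertex set is the disjoint union of sets $X_1,\ldots,X_k,Y_1,\ldots,Y_k$ with $|X_i|=x_i$, $|Y_i|=y_i$, in which $x\in X_i$ and $y\in Y_j$ are adjacent if and only if $i+j\le k+1$, with no other edges. Thus the graph in the claim has one vertex adjacent to all $n-2$ vertices of $Y_1\cup Y_2$ and one vertex adjacent to the $m-n+2$ vertices of $Y_1$. *)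

theory Defs
  imports
    "Graph_Theory.Graph_Theory"
    "Jordan_Normal_Form.Char_Poly"
begin

text \<open>
  A finite simple undirected graph is a \<^locale>\<open>pair_graph\<close>: a finite loop-free digraph
  with a symmetric arc set, so that an undirected edge \<open>uv\<close> is represented by the two
  arcs \<open>(u, v)\<close> and \<open>(v, u)\<close>.
\<close>

definition edges :: "'a pair_pre_digraph \<Rightarrow> 'a set set" where
  "edges G = (\<lambda>(u, v). {u, v}) ` parcs G"

definition bipartite :: "'a pair_pre_digraph \<Rightarrow> bool" where
  "bipartite G \<longleftrightarrow>
     (\<exists>X Y. X \<union> Y = pverts G \<and> X \<inter> Y = {} \<and> parcs G \<subseteq> X \<times> Y \<union> Y \<times> X)"

definition adjacency_matrix :: "'a pair_pre_digraph \<Rightarrow> 'a list \<Rightarrow> int mat" where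
  "adjacency_matrix G vs =
     mat (length vs) (length vs) (\<lambda>(i, j). if (vs ! i, vs ! j) \<in> parcs G then 1 else 0)"

text \<open>
  The characteristic polynomial does not depend on the enumeration of the (finitely many)
  vertices, since another enumeration conjugates the adjacency matrix by a permutation matrix.
\<close>

definition graph_char_poly :: "'a pair_pre_digraph \<Rightarrow> int poly" where
  "graph_char_poly G =
     char_poly (adjacency_matrix G (SOME vs. distinct vs \<and> set vs = pverts G))"

text \<open>Only meaningful for \<open>i \<le> card (pverts G)\<close>, because of the truncated subtraction.\<close>

definition char_coeff :: "nat \<Rightarrow> 'a pair_pre_digraph \<Rightarrow> int" where
  "char_coeff i G = coeff (graph_char_poly G) (card (pverts G) - i)"

definition connected_bipartite_graphs :: "nat \<Rightarrow> nat \<Rightarrow> 'a pair_pre_digraph set" where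
  "connected_bipartite_graphs n m =
     {G. pair_graph G \<and> Digraph_Component.connected (with_proj G) \<and> bipartite G \<and>
         card (pverts G) = n \<and> card (edges G) = m}"

text \<open>
  The competitors \<open>H\<close> have the same vertex type as \<open>G\<close>. This is no restriction: as \<open>G\<close> has
  \<open>n\<close> vertices, that type contains an isomorphic copy of every graph on \<open>n\<close> vertices.
\<close>

definition bipartite_optimal :: "nat \<Rightarrow> nat \<Rightarrow> 'a pair_pre_digraph \<Rightarrow> bool" where
  "bipartite_optimal n m G \<longleftrightarrow>
     is_arg_min (char_coeff 4) (\<lambda>H. H \<in> connected_bipartite_graphs n m) G"

text \<open>
  The vertex-eigenvector \<open>(x\<^sub>1, \<dots>, x\<^sub>k; y\<^sub>1, \<dots>, y\<^sub>k)\<close> is given by two lists of the same length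
  \<open>k\<close>. The blocks are \<open>X\<^sub>i = {Inl (i, a) | a < x\<^sub>i}\<close> and \<open>Y\<^sub>j = {Inr (j, b) | b < y\<^sub>j}\<close>, where
  \<open>i\<close> and \<open>j\<close> are counted from 1.
\<close>

definition difference_graph ::
    "nat list \<Rightarrow> nat list \<Rightarrow> (nat \<times> nat + nat \<times> nat) pair_pre_digraph" where
  "difference_graph xs ys =
    (let k = length xs;
         X = {Inl (i, a) | i a. 1 \<le> i \<and> i \<le> k \<and> a < xs ! (i - 1)};
         Y = {Inr (j, b) | j b. 1 \<le> j \<and> j \<le> k \<and> b < ys ! (j - 1)};
         E = {(Inl (i, a), Inr (j, b)) | i a j b. i + j \<le> k + 1} \<inter> X \<times> Y
     in \<lparr> pverts = X \<union> Y, parcs = E \<union> E\<inverse> \<rparr>)"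

end

theory Submission
  imports Defs
begin

text \<open>
  For a bipartite graph with biadjacency matrix \<open>B\<close>, the Leibniz formula shows that \<open>a\<^sub>4\<close> is the
  number of nonsingular \<open>2 \<times> 2\<close> submatrices of \<open>B\<close>: the permutations moving four points
  contribute the 2-matchings and, with the opposite sign, the oriented 4-cycles. Put
  \<open>t = m - n + 2\<close> and \<open>s = 2n - 4 - m\<close>; the claimed minimum is \<open>t s\<close>.

  Removing a leaf attached at \<open>u\<close> keeps \<open>t\<close>, lowers \<open>s\<close> by one and destroys \<open>m - d(u) \<ge> t\<close>
  submatrices, because \<open>d(u) \<le> n - 2\<close> in a connected graph that is not a star. Equality forces
  \<open>u\<close> to be adjacent to its whole opposite side while its own side has only two vertices, which
  already is the claimed graph. If there is no leaf, every zero of \<open>B\<close> lies in at least four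
  nonsingular submatrices, each with at most two zeros; hence \<open>a\<^sub>4 \<ge> 2(pq - m)\<close> for sides of
  sizes \<open>p\<close> and \<open>q\<close>, and this exceeds \<open>t s\<close>.
\<close>

section \<open>Nonsingular minors of a biadjacency matrix\<close>

text \<open>
  A nonsingular \<open>2 \<times> 2\<close> submatrix of a 0/1 matrix contains exactly one pair of ones in different
  rows and columns whose two other corners are not both one. The pairs are ordered, so every
  such submatrix is counted twice.
\<close>

definition nonsingular_pairs :: "('a \<times> 'b) set \<Rightarrow> (('a \<times> 'b) \<times> ('a \<times> 'b)) set" where
  "nonsingular_pairs E = {((x, y), (x', y')). (x, y) \<in> E \<and> (x', y') \<in> E \<and> x \<noteq> x' \<and> y \<noteq> y' \<and>
     \<not> ((x, y') \<in> E \<and> (x', y) \<in> E)}"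

lemma nonsingular_pairs_subset: "nonsingular_pairs E \<subseteq> E \<times> E"
  by (auto simp: nonsingular_pairs_def)

lemma finite_nonsingular_pairs: "finite E \<Longrightarrow> finite (nonsingular_pairs E)"
  by (rule finite_subset[OF nonsingular_pairs_subset]) simp

section \<open>Invariance under relabelling and transposition\<close>

lemma nonsingular_pairs_map_iff:
  assumes f: "inj_on f A" and g: "inj_on g B" and E: "E \<subseteq> A \<times> B"
    and e: "e \<in> E" and e': "e' \<in> E"
  shows "(map_prod f g e, map_prod f g e') \<in> nonsingular_pairs (map_prod f g ` E) \<longleftrightarrow>
    (e, e') \<in> nonsingular_pairs E"
proof -
  obtain x y x' y' where [simp]: "e = (x, y)" "e' = (x', y')" by fastforce
  have in': "x \<in> A" "x' \<in> A" "y \<in> B" "y' \<in> B" using e e' E by auto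
  have mem: "(f a, g b) \<in> map_prod f g ` E \<longleftrightarrow> (a, b) \<in> E" if "a \<in> A" "b \<in> B" for a b
  proof
    assume "(f a, g b) \<in> map_prod f g ` E"
    then obtain c d where "(c, d) \<in> E" "f a = f c" "g b = g d" by auto
    moreover from this have "c = a" "d = b"
      using E that f g by (auto dest!: inj_onD)
    ultimately show "(a, b) \<in> E" by simp
  next
    assume "(a, b) \<in> E"
    then show "(f a, g b) \<in> map_prod f g ` E" by force
  qed
  show ?thesis
    using in' f g by (simp add: nonsingular_pairs_def mem inj_on_eq_iff)
qed

text \<open>Carries the count from matrix indices to vertices. Injectivity is asked only on
  \<open>A\<close> and \<open>B\<close> because list indexing is injective only below the
  length.\<close>

lemma card_nonsingular_pairs_image:
  assumes f: "inj_on f A" and g: "inj_on g B" and E: "E \<subseteq> A \<times> B"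
  shows "card (nonsingular_pairs (map_prod f g ` E)) = card (nonsingular_pairs E)"
proof -
  let ?h = "map_prod f g"
  have inj: "inj_on ?h E"
    by (rule inj_on_subset[OF map_prod_inj_on[OF f g] E])
  have "nonsingular_pairs (?h ` E) = map_prod ?h ?h ` nonsingular_pairs E" (is "?L = ?R")
  proof (rule equalityI; rule subsetI)
    fix z assume z: "z \<in> ?L"
    then have "z \<in> ?h ` E \<times> ?h ` E" using nonsingular_pairs_subset by (rule subsetD[rotated])
    then obtain e e' where "e \<in> E" "e' \<in> E" "z = map_prod ?h ?h (e, e')" by auto
    moreover from this z have "(e, e') \<in> nonsingular_pairs E"
      using nonsingular_pairs_map_iff[OF assms] by simp
    ultimately show "z \<in> ?R" by blast
  next
    fix z assume "z \<in> ?R"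
    then obtain w where w: "w \<in> nonsingular_pairs E" "z = map_prod ?h ?h w"
      by (elim imageE)
    obtain e e' where ee: "w = (e, e')" by (rule prod.exhaust)
    have in': "e \<in> E" "e' \<in> E" using subsetD[OF nonsingular_pairs_subset w(1)] ee by simp_all
    have "(?h e, ?h e') \<in> ?L"
      using nonsingular_pairs_map_iff[OF assms in'] w(1) unfolding ee by (rule iffD2)
    then show "z \<in> ?L" unfolding w(2) ee by simp
  qed
  moreover have "inj_on (map_prod ?h ?h) (nonsingular_pairs E)"
    by (rule inj_on_subset[OF map_prod_inj_on[OF inj inj] nonsingular_pairs_subset])
  ultimately show ?thesis by (simp add: card_image)
qed

text \<open>Allows a leaf on either side to be treated as a leaf in \<open>Y\<close>.\<close>

lemma card_nonsingular_pairs_converse: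
  "card (nonsingular_pairs (E\<inverse>)) = card (nonsingular_pairs E)"
proof -
  have "nonsingular_pairs (E\<inverse>) = map_prod prod.swap prod.swap ` nonsingular_pairs E"
    by (force simp: nonsingular_pairs_def image_iff)
  moreover have "inj_on (map_prod prod.swap prod.swap) (nonsingular_pairs E)"
    by (auto simp: inj_on_def)
  ultimately show ?thesis by (simp add: card_image)
qed

section \<open>Contribution of leaves and of zeros\<close>

text \<open>Column \<open>v\<close> has its only one in row \<open>u\<close>. Every edge outside row
  \<open>u\<close> therefore forms a nonsingular minor with \<open>(u, v)\<close>, in either order,
  whence the factor 2. No other pair is affected: if \<open>(u, v)\<close> were one of its two
  remaining corners, one of its edges would lie in column \<open>v\<close> outside row
  \<open>u\<close>.\<close>

lemma card_nonsingular_pairs_leaf: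
  assumes "finite E" and uv: "(u, v) \<in> E" and leaf: "\<forall>x. (x, v) \<in> E \<longrightarrow> x = u"
  shows "int (card (nonsingular_pairs E)) =
    int (card (nonsingular_pairs (E - {(u, v)}))) + 2 * (int (card E) - int (card (E `` {u})))"
proof -
  define F where "F = {e \<in> E. fst e \<noteq> u}"
  have fin: "finite F" "finite (E - {(u, v)})"
    using assms(1) by (auto simp: F_def)
  have split: "nonsingular_pairs E =
      nonsingular_pairs (E - {(u, v)}) \<union> (Pair (u, v) ` F \<union> (\<lambda>e. (e, (u, v))) ` F)"
    (is "_ = ?R")
  proof (rule equalityI; rule subsetI)
    fix z assume z: "z \<in> nonsingular_pairs E"
    obtain a b c d where abcd: "z = ((a, b), (c, d))" by (metis prod.exhaust)
    have h: "(a, b) \<in> E" "(c, d) \<in> E" "a \<noteq> c" "b \<noteq> d" "\<not> ((a, d) \<in> E \<and> (c, b) \<in> E)"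
      using z abcd by (auto simp: nonsingular_pairs_def)
    consider "(a, b) = (u, v)" | "(c, d) = (u, v)" | "(a, b) \<noteq> (u, v)" "(c, d) \<noteq> (u, v)"
      by blast
    then show "z \<in> ?R"
    proof cases
      case 1
      then show ?thesis using h abcd by (simp add: F_def)
    next
      case 2
      then show ?thesis using h abcd by (simp add: F_def)
    next
      case 3
      then have "z \<in> nonsingular_pairs (E - {(u, v)})"
        using h abcd by (simp add: nonsingular_pairs_def) blast
      then show ?thesis by blast
    qed
  next
    fix z assume "z \<in> ?R"
    then consider "z \<in> nonsingular_pairs (E - {(u, v)})"
      | a b where "(a, b) \<in> E" "a \<noteq> u" "z = ((u, v), (a, b)) \<or> z = ((a, b), (u, v))"
      unfolding F_def by force
    then show "z \<in> nonsingular_pairs E"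
    proof cases
      case 1
      obtain a b c d where abcd: "z = ((a, b), (c, d))" by (metis prod.exhaust)
      have h: "(a, b) \<in> E" "(c, d) \<in> E" "a \<noteq> c" "b \<noteq> d"
          "(a, d) \<in> E - {(u, v)} \<longrightarrow> (c, b) \<notin> E - {(u, v)}"
        using 1 abcd by (simp_all add: nonsingular_pairs_def, blast)
      have "(a, d) \<noteq> (u, v)" "(c, b) \<noteq> (u, v)"
        using leaf h(1-3) by blast+
      then show ?thesis using h abcd by (simp add: nonsingular_pairs_def)
    next
      case 2
      then have "b \<noteq> v" "(a, v) \<notin> E" using leaf by blast+
      then show ?thesis using 2 uv by (auto simp: nonsingular_pairs_def)
    qed
  qed
  have d1: "nonsingular_pairs (E - {(u, v)}) \<inter> (Pair (u, v) ` F \<union> (\<lambda>e. (e, (u, v))) ` F) = {}"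
    by (auto simp: nonsingular_pairs_def)
  have d2: "Pair (u, v) ` F \<inter> (\<lambda>e. (e, (u, v))) ` F = {}"
    by (auto simp: F_def)
  have "card (nonsingular_pairs E) = card (nonsingular_pairs (E - {(u, v)})) + (card F + card F)"
    unfolding split using fin
    by (subst card_Un_disjoint[OF _ _ d1])
       (auto simp: finite_nonsingular_pairs card_Un_disjoint[OF _ _ d2] card_image inj_on_def)
  moreover have "card E = card F + card (E `` {u})"
  proof -
    have "E = F \<union> Pair u ` (E `` {u})" "F \<inter> Pair u ` (E `` {u}) = {}"
      by (auto simp: F_def)
    moreover have "finite (E `` {u})"
      using assms(1) by (simp add: finite_Image)
    ultimately show ?thesis
      using fin card_Un_disjoint[of F "Pair u ` (E `` {u})"] by (simp add: card_image inj_on_def)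
  qed
  ultimately show ?thesis by simp
qed

lemma zeros_le_card_nonsingular_pairs:
  assumes fin: "finite X" "finite Y" and E: "E \<subseteq> X \<times> Y"
    and degX: "\<And>x. x \<in> X \<Longrightarrow> k \<le> card (E `` {x})" and degY: "\<And>y. y \<in> Y \<Longrightarrow> l \<le> card (E\<inverse> `` {y})"
  shows "k * l * card (X \<times> Y - E) \<le> card (nonsingular_pairs E)"
proof -
  \<comment> \<open>If \<open>(x, y)\<close> is a zero, every choice of edges \<open>(x, y')\<close> and \<open>(x', y)\<close> gives the minor with rows
    \<open>0 1\<close> and \<open>1 *\<close>, which is nonsingular.\<close>
  define S where "S = (SIGMA z : X \<times> Y - E. E `` {fst z} \<times> E\<inverse> `` {snd z})"
  have finE: "finite E" using fin E by (meson finite_SigmaI finite_subset)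
  have "k * l * card (X \<times> Y - E) = (\<Sum>z\<in>X \<times> Y - E. k * l)" by simp
  also have "\<dots> \<le> (\<Sum>z\<in>X \<times> Y - E. card (E `` {fst z} \<times> E\<inverse> `` {snd z}))"
    by (rule sum_mono) (auto simp: card_cartesian_product intro!: mult_le_mono degX degY)
  also have "\<dots> = card S"
    unfolding S_def using fin finE by (subst card_SigmaI) (auto simp: finite_Image)
  also have "\<dots> \<le> card (nonsingular_pairs E)"
  \<comment> \<open>The zero is recovered as the row of the first edge and the column of the second.
    A minor with two zeros is thus hit once for each order of its pair, and injectivity
    survives.\<close>
  proof (rule card_inj_on_le[where f = "\<lambda>((x, y), (y', x')). ((x, y'), (x', y))"])
    show "inj_on (\<lambda>((x, y), (y', x')). ((x, y'), (x', y))) S"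
      by (auto simp: inj_on_def)
    show "(\<lambda>((x, y), (y', x')). ((x, y'), (x', y))) ` S \<subseteq> nonsingular_pairs E"
      by (auto simp: S_def nonsingular_pairs_def)
  qed (use finE in \<open>rule finite_nonsingular_pairs\<close>)
  finally show ?thesis .
qed

section \<open>Connectivity through closed vertex sets\<close>

text \<open>Sets closed under adjacency replace paths, so that deleting a leaf or transposing
  becomes a computation with sets. The two sides may have different types.\<close>

definition bip_connected :: "'a set \<Rightarrow> 'b set \<Rightarrow> ('a \<times> 'b) set \<Rightarrow> bool" where
  "bip_connected X Y E \<longleftrightarrow> (\<forall>A B. A \<subseteq> X \<longrightarrow> B \<subseteq> Y \<longrightarrow> (\<forall>(x, y)\<in>E. x \<in> A \<longleftrightarrow> y \<in> B) \<longrightarrow>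
     (A = {} \<and> B = {}) \<or> (A = X \<and> B = Y))"

lemma bip_connectedD:
  assumes "bip_connected X Y E" "A \<subseteq> X" "B \<subseteq> Y" "\<And>x y. (x, y) \<in> E \<Longrightarrow> x \<in> A \<longleftrightarrow> y \<in> B"
  shows "(A = {} \<and> B = {}) \<or> (A = X \<and> B = Y)"
  using assms(1)[unfolded bip_connected_def, rule_format, OF assms(2,3)] assms(4)
  by (simp add: case_prod_unfold)

lemma bip_connected_converse:
  assumes "bip_connected X Y E"
  shows "bip_connected Y X (E\<inverse>)"
  unfolding bip_connected_def
proof (intro allI impI)
  fix B A
  assume "B \<subseteq> Y" "A \<subseteq> X" "\<forall>(y, x)\<in>E\<inverse>. (y \<in> B) = (x \<in> A)"
  then have "(A = {} \<and> B = {}) \<or> (A = X \<and> B = Y)"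
    by (intro bip_connectedD[OF assms]) auto
  then show "(B = {} \<and> A = {}) \<or> (B = Y \<and> A = X)" by blast
qed

text \<open>A closed set of the smaller graph is closed in the original one after \<open>v\<close>
  is added exactly when the set contains \<open>u\<close>.\<close>

lemma bip_connected_remove_leaf:
  assumes con: "bip_connected X Y E" and "E \<subseteq> X \<times> Y" "(u, v) \<in> E"
    and leaf: "\<forall>x. (x, v) \<in> E \<longrightarrow> x = u"
  shows "bip_connected X (Y - {v}) (E - {(u, v)})"
  unfolding bip_connected_def
proof (intro allI impI)
  fix A B
  assume A: "A \<subseteq> X" and B: "B \<subseteq> Y - {v}" and cl: "\<forall>(x, y)\<in>E - {(u, v)}. (x \<in> A) = (y \<in> B)"
  have uX: "u \<in> X" and vY: "v \<in> Y" using assms(2,3) by auto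
  show "A = {} \<and> B = {} \<or> A = X \<and> B = Y - {v}"
  proof (cases "u \<in> A")
    case True
    have "(A = {} \<and> insert v B = {}) \<or> (A = X \<and> insert v B = Y)"
    proof (rule bip_connectedD[OF con A])
      show "insert v B \<subseteq> Y" using B vY by blast
      show "x \<in> A \<longleftrightarrow> y \<in> insert v B" if "(x, y) \<in> E" for x y
        using that cl True leaf B by (cases "y = v") auto
    qed
    then show ?thesis using B by auto
  next
    case False
    have "(A = {} \<and> B = {}) \<or> (A = X \<and> B = Y)"
    proof (rule bip_connectedD[OF con A])
      show "B \<subseteq> Y" using B by blast
      show "x \<in> A \<longleftrightarrow> y \<in> B" if "(x, y) \<in> E" for x y
        using that cl False leaf B by (cases "y = v") auto
    qed
    then show ?thesis using False uX by auto
  qed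
qed

text \<open>An isolated \<open>y\<close> would itself be a closed set. Hence a vertex of degree
  below two is a leaf.\<close>

lemma bip_connected_degree_pos:
  assumes con: "bip_connected X Y E" and "X \<noteq> {}" "y \<in> Y" 
  shows "E\<inverse> `` {y} \<noteq> {}"
proof
  assume "E\<inverse> `` {y} = {}"
  then have "\<And>x z. (x, z) \<in> E \<Longrightarrow> x \<in> {} \<longleftrightarrow> z \<in> {y}" by auto
  from bip_connectedD[OF con _ _ this] assms(3) have "X = {}" by simp
  with assms(2) show False by auto
qed

section \<open>The lower bound and its equality case\<close>

text \<open>Numerical comparison for graphs without leaves, where \<open>p\<close> and
  \<open>q\<close> are the sizes of the sides and \<open>m\<close> counts edges. Both sides are
  doubled, in accordance with ordered pairs.\<close>

lemma min_degree_two_bound: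
  fixes p q m :: int
  assumes "2 * p \<le> m" "2 * q \<le> m" "p \<ge> 2" "q \<ge> 2" and s: "2 * (p + q) - 4 - m \<ge> 1"
  shows "2 * (m - (p + q) + 2) * (2 * (p + q) - 4 - m) < 4 * (p * q - m)"
proof -
  have ineq: "s * (P + Q - s) < 2 * P * Q" if "1 \<le> s" "s \<le> 2 * P" "P \<le> Q" for s P Q :: int
  proof -
    \<comment> \<open>For \<open>s \<ge> P\<close> both summands on the right are nonnegative and
      one is positive. For \<open>s < P\<close> the second is negative, but it is outweighed:
      \<open>s * (P - s) < P * P \<le> Q * (2 * P - s)\<close>.\<close>
    have id: "2 * P * Q - s * (P + Q - s) = Q * (2 * P - s) + s * (s - P)"
      by (simp add: algebra_simps)
    have "0 < Q * (2 * P - s) + s * (s - P)"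
    proof (cases "s \<ge> P")
      case True
      then have *: "Q * (2 * P - s) \<ge> 0" "s * (s - P) \<ge> 0" using that by auto
      show ?thesis
      proof (cases "s = P")
        case True
        then have "Q * (2 * P - s) > 0" using that by simp
        with * show ?thesis by linarith
      next
        case False
        then have "s * (s - P) > 0" using that True by simp
        with * show ?thesis by linarith
      qed
    next
      case False
      have "s * (P - s) < P * P"
        using False that by (intro mult_strict_mono) auto
      also have "P * P \<le> Q * (2 * P - s)"
        using False that by (intro mult_mono) auto
      finally show ?thesis by (simp add: algebra_simps)
    qed
    with id show ?thesis by linarith
  qed
  define s where "s = 2 * (p + q) - 4 - m"
  \<comment> \<open>With \<open>P = p - 2\<close> and \<open>Q = q - 2\<close> one has
    \<open>p * q - m = P * Q + s\<close> and \<open>m - (p + q) + 2 = P + Q + 2 - s\<close>, so the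
    claim reduces to \<open>ineq\<close>. The bound \<open>2 * q \<le> m\<close> turns into
    \<open>s \<le> 2 * P\<close>, and symmetrically for \<open>p\<close>.\<close>
  have "s * ((p - 2) + (q - 2) - s) < 2 * (p - 2) * (q - 2)"
  proof (cases "p \<le> q")
    case True
    then show ?thesis using assms by (intro ineq) (auto simp: s_def)
  next
    case False
    then have "s * ((q - 2) + (p - 2) - s) < 2 * (q - 2) * (p - 2)"
      using assms by (intro ineq) (auto simp: s_def)
    then show ?thesis by (simp add: algebra_simps)
  qed
  then show ?thesis unfolding s_def by (simp add: algebra_simps)
qed

text \<open>The shape of the equality case. The neighbourhood of \<open>u'\<close> is left open, as
  the number of edges will determine its size.\<close>

definition dominating_pair :: "'a set \<Rightarrow> 'b set \<Rightarrow> ('a \<times> 'b) set \<Rightarrow> bool" where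
  "dominating_pair X Y E \<longleftrightarrow> (\<exists>u u'. u \<noteq> u' \<and> X = {u, u'} \<and> {u} \<times> Y \<subseteq> E)"

lemma card_edges_by_degree:
  assumes "finite X" "finite Y" "E \<subseteq> X \<times> Y"
  shows "card E = (\<Sum>x\<in>X. card (E `` {x}))"
proof -
  have "E = (SIGMA x:X. E `` {x})" using assms by auto
  moreover have "card (SIGMA x:X. E `` {x}) = (\<Sum>x\<in>X. card (E `` {x}))"
    by (rule card_SigmaI) (use assms in \<open>auto intro: finite_subset[of _ Y]\<close>)
  ultimately show ?thesis by simp
qed

text \<open>Deleting the leaf \<open>v\<close> keeps \<open>t\<close>, lowers \<open>s\<close> by
  one and destroys twice \<open>card E - d\<close> pairs, \<open>d\<close> being the degree of
  \<open>u\<close>. From \<open>d \<le> card Y\<close> and \<open>card X \<ge> 2\<close> this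
  difference is at least \<open>t\<close>. Equality forces both estimates to be sharp, so the
  structure is read off from this one leaf and the smaller graph enters only through its
  inequality.\<close>

lemma card_nonsingular_pairs_ge_step:
  assumes fin: "finite X" "finite Y" and E: "E \<subseteq> X \<times> Y"
    and uv: "(u, v) \<in> E" and leaf: "\<forall>x. (x, v) \<in> E \<longrightarrow> x = u"
    and X2: "card X \<ge> 2"
    and t: "t = int (card E) - int (card X + card Y) + 2"
    and s: "s = 2 * int (card X + card Y) - 4 - int (card E)"
    and IH: "2 * t * (s - 1) \<le> int (card (nonsingular_pairs (E - {(u, v)})))"
  shows "2 * t * s \<le> int (card (nonsingular_pairs E)) \<and>
    (int (card (nonsingular_pairs E)) = 2 * t * s \<longrightarrow> dominating_pair X Y E)"
proof -
  have finE: "finite E" using fin E by (meson finite_SigmaI finite_subset)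
  have sub: "E `` {u} \<subseteq> Y" using E by auto
  then have d: "card (E `` {u}) \<le> card Y" using fin by (simp add: card_mono)
  note eq = card_nonsingular_pairs_leaf[OF finE uv leaf]
  have ge: "int (card E) - int (card (E `` {u})) \<ge> t"
    using d X2 t by linarith
  have IH': "2 * t * s - 2 * t \<le> int (card (nonsingular_pairs (E - {(u, v)})))"
    using IH by (simp add: algebra_simps)
  \<comment> \<open>Abstracting the product \<open>2 * t * s\<close> to \<open>w\<close> leaves a
    linear problem.\<close>
  have arith: "w \<le> N" "N = w \<Longrightarrow> D = t" if "N = N' + 2 * D" "t \<le> D" "w - 2 * t \<le> N'"
    for N N' D w :: int
    using that by linarith+
  have "dominating_pair X Y E" if "int (card (nonsingular_pairs E)) = 2 * t * s"
  proof -
    have "int (card E) - int (card (E `` {u})) = t"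
      using eq ge IH' that by (rule arith(2))
    then have "card (E `` {u}) = card Y" and X2': "card X = 2"
      using d X2 t by linarith+
    then have "E `` {u} = Y" using sub fin by (simp add: card_subset_eq)
    moreover have "u \<in> X" using uv E by auto
    moreover obtain u' where "X = {u, u'}" "u \<noteq> u'"
      using X2' \<open>u \<in> X\<close> by (auto simp: card_2_iff)
    ultimately show ?thesis unfolding dominating_pair_def by blast
  qed
  moreover have "2 * t * s \<le> int (card (nonsingular_pairs E))"
    using eq ge IH' by (rule arith(1))
  ultimately show ?thesis by blast
qed

text \<open>Strong induction on the number of edges. Deleting a leaf preserves the hypothesis that
  there are at least as many edges as vertices; without leaves the inequality is strict.\<close>

lemma card_nonsingular_pairs_ge:
  assumes "finite X" "finite Y" "E \<subseteq> X \<times> Y" "bip_connected X Y E"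
    and "card X + card Y \<le> card E"
    and "t = int (card E) - int (card X + card Y) + 2"
    and "s = 2 * int (card X + card Y) - 4 - int (card E)" and "s \<ge> 1"
  shows "2 * t * s \<le> int (card (nonsingular_pairs E)) \<and>
    (int (card (nonsingular_pairs E)) = 2 * t * s \<longrightarrow>
      dominating_pair X Y E \<or> dominating_pair Y X (E\<inverse>))"
  using assms
proof (induction "card E" arbitrary: X Y E t s rule: less_induct)
  case less
  note fin = less.prems(1,2) and E = less.prems(3) and con = less.prems(4)
  have finE: "finite E" using fin E by (meson finite_SigmaI finite_subset)
  have "card E \<le> card X * card Y"
    using card_mono[OF _ E] fin by (simp add: card_cartesian_product)
  \<comment> \<open>A side with at most one vertex leaves room for too few edges. Only the empty
    graph escapes this count, and there \<open>s = -4\<close>.\<close>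
  have small: "\<not> (card X \<le> 1 \<or> card Y \<le> 1)"
  proof
    assume "card X \<le> 1 \<or> card Y \<le> 1"
    then have "card X * card Y \<le> card X \<or> card X * card Y \<le> card Y"
      by (metis mult.commute mult_le_mono1 mult_1)
    then have "card E \<le> card X \<or> card E \<le> card Y"
      using \<open>card E \<le> card X * card Y\<close> by linarith
    with less.prems(5) \<open>card X \<le> 1 \<or> card Y \<le> 1\<close> \<open>card E \<le> card X * card Y\<close>
    have "card X = 0 \<or> card Y = 0" by linarith
    with \<open>card E \<le> card X * card Y\<close> less.prems(5) have "card X = 0" "card Y = 0" "card E = 0" by auto
    with less.prems(7,8) show False by simp
  qed
  then have X2: "card X \<ge> 2" and Y2: "card Y \<ge> 2" by auto
  \<comment> \<open>Stated for arbitrary side types, to serve both orientations. The induction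
    hypothesis is a premise because it speaks of relations from the type of \<open>X\<close> to that
    of \<open>Y\<close>; for a leaf in \<open>X\<close> it has to be transposed first.\<close>
  have leaf_case: "2 * t * s \<le> int (card (nonsingular_pairs E')) \<and>
      (int (card (nonsingular_pairs E')) = 2 * t * s \<longrightarrow> dominating_pair X' Y' E')"
    if h: "finite X'" "finite Y'" "E' \<subseteq> X' \<times> Y'" "bip_connected X' Y' E'" "card X' \<ge> 2"
      "card E' = card E" "card X' + card Y' = card X + card Y"
      and uv: "(u, v) \<in> E'" and leaf: "\<forall>x. (x, v) \<in> E' \<longrightarrow> x = u"
      and IH: "\<And>t' s'. card (E' - {(u, v)}) < card E \<Longrightarrow> E' - {(u, v)} \<subseteq> X' \<times> (Y' - {v}) \<Longrightarrow>
        bip_connected X' (Y' - {v}) (E' - {(u, v)}) \<Longrightarrow>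
        card X' + card (Y' - {v}) \<le> card (E' - {(u, v)}) \<Longrightarrow>
        t' = int (card (E' - {(u, v)})) - int (card X' + card (Y' - {v})) + 2 \<Longrightarrow>
        s' = 2 * int (card X' + card (Y' - {v})) - 4 - int (card (E' - {(u, v)})) \<Longrightarrow> s' \<ge> 1 \<Longrightarrow>
        2 * t' * s' \<le> int (card (nonsingular_pairs (E' - {(u, v)})))"
    for X' :: "'c set" and Y' :: "'d set" and E' u v
  proof (rule card_nonsingular_pairs_ge_step[OF h(1-3) uv leaf h(5)])
    have vY: "v \<in> Y'" using uv h(3) by auto
    have finE': "finite E'" using h(1-3) by (meson finite_SigmaI finite_subset)
    have cE: "card E' = Suc (card (E' - {(u, v)}))"
      using card_Suc_Diff1[OF finE' uv] by simp
    have cY: "card Y' = Suc (card (Y' - {v}))"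
      using card_Suc_Diff1[OF h(2) vY] by simp
    show "2 * t * (s - 1) \<le> int (card (nonsingular_pairs (E' - {(u, v)})))"
    proof (cases "s - 1 \<ge> 1")
      case True
      show ?thesis
      proof (rule IH)
        show "E' - {(u, v)} \<subseteq> X' \<times> (Y' - {v})" using h(3) leaf by auto
        show "bip_connected X' (Y' - {v}) (E' - {(u, v)})"
          by (rule bip_connected_remove_leaf[OF h(4,3) uv leaf])
        show "card (E' - {(u, v)}) < card E" using cE h(6) by linarith
        show "card X' + card (Y' - {v}) \<le> card (E' - {(u, v)})"
          using cE cY h(6,7) less.prems(5) by linarith
        show "t = int (card (E' - {(u, v)})) - int (card X' + card (Y' - {v})) + 2"
          unfolding less.prems(6) h(6,7)[symmetric] cE cY by simp
        show "s - 1 = 2 * int (card X' + card (Y' - {v})) - 4 - int (card (E' - {(u, v)}))"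
          unfolding less.prems(7) h(6,7)[symmetric] cE cY by simp
      qed (rule True)
    next
      \<comment> \<open>The induction hypothesis does not apply at \<open>s = 1\<close>, but the
        bound for the smaller graph is then zero.\<close>
      case False
      then have "s = 1" using less.prems(8) by linarith
      then show ?thesis by simp
    qed
    show "t = int (card E') - int (card X' + card Y') + 2"
      using less.prems(6) h(6,7) by simp
    show "s = 2 * int (card X' + card Y') - 4 - int (card E')"
      using less.prems(7) h(6,7) by simp
  qed
  \<comment> \<open>In both leaf cases \<open>v\<close> is the leaf and \<open>u\<close> its
    neighbour, so that case \<open>X\<close> matches \<open>leaf_case\<close> for the converse
    relation.\<close>
  consider (Y) u v where "(u, v) \<in> E" "\<forall>x. (x, v) \<in> E \<longrightarrow> x = u"
    | (X) u v where "(v, u) \<in> E" "\<forall>x. (v, x) \<in> E \<longrightarrow> x = u"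
    | (two) "\<And>x. x \<in> X \<Longrightarrow> 2 \<le> card (E `` {x})" "\<And>y. y \<in> Y \<Longrightarrow> 2 \<le> card (E\<inverse> `` {y})"
  proof -
    have "X \<noteq> {}" "Y \<noteq> {}" using X2 Y2 by auto
    have one: "\<exists>a. A = {a}" if "finite A" "A \<noteq> {}" "\<not> 2 \<le> card A" for A :: "'z set"
    proof -
      have "card A \<noteq> 0" using that by simp
      then have "card A = 1" using that(3) by linarith
      then show ?thesis by (rule card_1_singletonE) blast
    qed
    have Y1: "\<exists>u. E\<inverse> `` {y} = {u}" if "y \<in> Y" "\<not> 2 \<le> card (E\<inverse> `` {y})" for y
      by (rule one) (use bip_connected_degree_pos[OF con \<open>X \<noteq> {}\<close> that(1)] that finE
          in \<open>auto simp: finite_Image\<close>)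
    have X1: "\<exists>u. E `` {x} = {u}" if "x \<in> X" "\<not> 2 \<le> card (E `` {x})" for x
      by (rule one) (use bip_connected_degree_pos[OF bip_connected_converse[OF con] \<open>Y \<noteq> {}\<close> that(1)]
          that finE in \<open>auto simp: finite_Image\<close>)
    show ?thesis
    proof (cases "(\<forall>x\<in>X. 2 \<le> card (E `` {x})) \<and> (\<forall>y\<in>Y. 2 \<le> card (E\<inverse> `` {y}))")
      case True
      then show ?thesis using two by blast
    next
      case False
      then consider x where "x \<in> X" "\<not> 2 \<le> card (E `` {x})"
        | y where "y \<in> Y" "\<not> 2 \<le> card (E\<inverse> `` {y})" by blast
      then show ?thesis
      proof cases
        case 1
        from X1[OF this] obtain u where "E `` {x} = {u}" by blast
        then show ?thesis by (intro X[of x u]) blast+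
      next
        case 2
        from Y1[OF this] obtain u where "E\<inverse> `` {y} = {u}" by blast
        then show ?thesis by (intro Y[of u y]) blast+
      qed
    qed
  qed
  then show ?case
  proof cases
    case Y
    have "2 * t * s \<le> int (card (nonsingular_pairs E)) \<and>
      (int (card (nonsingular_pairs E)) = 2 * t * s \<longrightarrow> dominating_pair X Y E)"
    proof (rule leaf_case[OF fin E con X2 refl refl Y])
      fix t' s'
      let ?E = "E - {(u, v)}"
      assume a: "card ?E < card E" "?E \<subseteq> X \<times> (Y - {v})" "bip_connected X (Y - {v}) ?E"
        "card X + card (Y - {v}) \<le> card ?E"
        "t' = int (card ?E) - int (card X + card (Y - {v})) + 2"
        "s' = 2 * int (card X + card (Y - {v})) - 4 - int (card ?E)" "s' \<ge> 1"
      show "2 * t' * s' \<le> int (card (nonsingular_pairs ?E))"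
        by (rule less.hyps[THEN conjunct1, OF a(1) fin(1) finite_Diff[OF fin(2)] a(2-7)])
    qed
    then show ?thesis by blast
  next
    case X
    have "2 * t * s \<le> int (card (nonsingular_pairs (E\<inverse>))) \<and>
      (int (card (nonsingular_pairs (E\<inverse>))) = 2 * t * s \<longrightarrow> dominating_pair Y X (E\<inverse>))"
    proof (rule leaf_case[OF fin(2,1) _ bip_connected_converse[OF con] Y2])
      fix t' s'
      let ?E = "E\<inverse> - {(u, v)}"
      have conv: "(E - {(v, u)})\<inverse> = ?E" by auto
      have card: "card ?E = card (E - {(v, u)})" unfolding conv[symmetric] by (rule card_inverse)
      assume a: "card ?E < card E" "?E \<subseteq> Y \<times> (X - {v})" "bip_connected Y (X - {v}) ?E"
        "card Y + card (X - {v}) \<le> card ?E"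
        "t' = int (card ?E) - int (card Y + card (X - {v})) + 2"
        "s' = 2 * int (card Y + card (X - {v})) - 4 - int (card ?E)" "s' \<ge> 1"
      have con': "bip_connected (X - {v}) Y (E - {(v, u)})"
        using bip_connected_converse[OF a(3)] unfolding conv[symmetric] converse_converse .
      have sub': "E - {(v, u)} \<subseteq> (X - {v}) \<times> Y" using a(2) by auto
      have "2 * t' * s' \<le> int (card (nonsingular_pairs (E - {(v, u)})))"
      proof (rule less.hyps[THEN conjunct1, OF _ finite_Diff[OF fin(1)] fin(2) sub' con'])
        show "card (E - {(v, u)}) < card E"
          "card (X - {v}) + card Y \<le> card (E - {(v, u)})"
          using a(1,4) unfolding card by linarith+
        show "t' = int (card (E - {(v, u)})) - int (card (X - {v}) + card Y) + 2"
          using a(5) unfolding card by simp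
        show "s' = 2 * int (card (X - {v}) + card Y) - 4 - int (card (E - {(v, u)}))"
          using a(6) unfolding card by simp
      qed (rule a(7))
      then show "2 * t' * s' \<le> int (card (nonsingular_pairs ?E))"
        unfolding conv[symmetric] card_nonsingular_pairs_converse .
    next
      show "E\<inverse> \<subseteq> Y \<times> X" using E by blast
      show "card (E\<inverse>) = card E" by simp
      show "card Y + card X = card X + card Y" by simp
      show "(u, v) \<in> E\<inverse>" "\<forall>x. (x, v) \<in> E\<inverse> \<longrightarrow> x = u" using X by blast+
    qed
    then show ?thesis by (simp add: card_nonsingular_pairs_converse)
  next
    case two
    \<comment> \<open>Each zero accounts for four ordered pairs. The resulting inequality is strict,
      which makes the equality clause vacuous.\<close>
    have "2 * 2 * card (X \<times> Y - E) \<le> card (nonsingular_pairs E)"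
      by (rule zeros_le_card_nonsingular_pairs[OF fin E two])
    moreover have "int (card (X \<times> Y - E)) = int (card X) * int (card Y) - int (card E)"
      using card_Diff_subset[OF finE E] \<open>card E \<le> card X * card Y\<close>
      by (simp add: card_cartesian_product of_nat_diff)
    moreover have "2 * card X \<le> card E"
      unfolding card_edges_by_degree[OF fin E]
      using sum_bounded_below[of X 2 "\<lambda>x. card (E `` {x})"] two(1) by (simp add: mult.commute)
    moreover have "2 * card Y \<le> card E"
    proof -
      have "card E = card (E\<inverse>)" by simp
      also have "\<dots> = (\<Sum>y\<in>Y. card (E\<inverse> `` {y}))"
        by (rule card_edges_by_degree) (use fin E in auto)
      finally show ?thesis
        using sum_bounded_below[of Y 2 "\<lambda>y. card (E\<inverse> `` {y})"] two(2) by (simp add: mult.commute)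
    qed
    moreover from calculation
    have "2 * t * s < 4 * (int (card X) * int (card Y) - int (card E))"
      using min_degree_two_bound[of "int (card X)" "int (card E)" "int (card Y)"]
        X2 Y2 less.prems(8) unfolding less.prems(6,7) by simp
    ultimately have "2 * t * s < 4 * int (card (X \<times> Y - E))"
      "4 * int (card (X \<times> Y - E)) \<le> int (card (nonsingular_pairs E))"
      by simp_all
    then have "2 * t * s < int (card (nonsingular_pairs E))" by (rule less_le_trans)
    then show ?thesis by simp
  qed
qed

section \<open>The fourth coefficient of the characteristic polynomial\<close>

lemma const_poly_prod: "(\<Prod>i\<in>A. [:f i:]) = [:\<Prod>i\<in>A. f i :: 'a :: comm_ring_1:]"
  by (induction A rule: infinite_finite_induct) (auto simp: one_pCons)

text \<open>In the Leibniz expansion every fixed point of \<open>p\<close> contributes the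
  indeterminate and every moved point a constant. A permutation thus yields a single monomial, whose
  degree is the number of its fixed points.\<close>

lemma coeff_char_poly_zero_diagonal:
  fixes M :: "int mat"
  assumes M: "M \<in> carrier_mat n n" and diag: "\<And>i. i < n \<Longrightarrow> M $$ (i, i) = 0" and "k \<le> n"
  shows "coeff (char_poly M) (n - k) =
    (\<Sum>p | p permutes {0..<n} \<and> card {i. p i \<noteq> i} = k.
       sign p * (\<Prod>i | p i \<noteq> i. - M $$ (i, p i)))"
proof -
  have entry: "char_poly_matrix M $$ (i, p i) =
      (if p i = i then monom 1 1 else [:- M $$ (i, p i):])"
    if "p permutes {0..<n}" "i < n" for p i
  proof -
    have "p i < n" using permutes_in_image[OF that(1), of i] that(2) by simp
    with that(2) M show ?thesis
      by (simp add: char_poly_matrix_def diag x_as_monom)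
  qed
  have supp: "{i. p i \<noteq> i} \<subseteq> {0..<n}" if "p permutes {0..<n}" for p
    using permutes_not_in[OF that] by blast
  have prod: "(\<Prod>i = 0..<n. char_poly_matrix M $$ (i, p i)) =
      monom (\<Prod>i | p i \<noteq> i. - M $$ (i, p i)) (n - card {i. p i \<noteq> i})"
    if p: "p permutes {0..<n}" for p
  proof -
    let ?S = "{i. p i \<noteq> i}"
    have fin: "finite ?S" using supp[OF p] finite_subset by blast
    have "(\<Prod>i = 0..<n. char_poly_matrix M $$ (i, p i)) =
      (\<Prod>i\<in>{0..<n} - ?S. char_poly_matrix M $$ (i, p i)) * (\<Prod>i\<in>?S. char_poly_matrix M $$ (i, p i))"
      by (rule prod.subset_diff[OF supp[OF p]]) simp
    also have "(\<Prod>i\<in>{0..<n} - ?S. char_poly_matrix M $$ (i, p i)) =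
        (\<Prod>i\<in>{0..<n} - ?S. monom 1 1)"
    proof (rule prod.cong[OF refl])
      fix i assume "i \<in> {0..<n} - ?S"
      then show "char_poly_matrix M $$ (i, p i) = monom 1 1"
        using entry[OF p, of i] by simp
    qed
    also have "\<dots> = monom 1 (n - card ?S)"
      using supp[OF p] fin by (simp add: card_Diff_subset monom_power)
    also have "(\<Prod>i\<in>?S. char_poly_matrix M $$ (i, p i)) = (\<Prod>i\<in>?S. [:- M $$ (i, p i):])"
      using supp[OF p] by (intro prod.cong refl) (simp add: entry[OF p] subset_iff)
    also have "\<dots> = [:\<Prod>i\<in>?S. - M $$ (i, p i):]"
      by (rule const_poly_prod)
    finally show ?thesis by (simp add: monom_0[symmetric] mult_monom)
  qed
  have expand: "char_poly M = (\<Sum>p | p permutes {0..<n}.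
      signof p * (\<Prod>i = 0..<n. char_poly_matrix M $$ (i, p i)))"
    unfolding char_poly_def using M by (intro det_def') simp
  have "coeff (char_poly M) (n - k) = (\<Sum>p | p permutes {0..<n}.
      sign p * (if card {i. p i \<noteq> i} = k then \<Prod>i | p i \<noteq> i. - M $$ (i, p i) else 0))"
    unfolding expand coeff_sum
  proof (rule sum.cong[OF refl])
    fix p assume "p \<in> {p. p permutes {0..<n}}"
    then have p: "p permutes {0..<n}" by simp
    have "card {i. p i \<noteq> i} \<le> n" using card_mono[OF _ supp[OF p]] by simp
    \<comment> \<open>Truncated subtraction from \<open>n\<close> is injective on numbers up to
      \<open>n\<close>; this is where \<open>k \<le> n\<close> enters.\<close>
    then have "n - card {i. p i \<noteq> i} = n - k \<longleftrightarrow> card {i. p i \<noteq> i} = k"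
      using assms(3) by auto
    then show "coeff (signof p * (\<Prod>i = 0..<n. char_poly_matrix M $$ (i, p i))) (n - k) =
      sign p * (if card {i. p i \<noteq> i} = k then \<Prod>i | p i \<noteq> i. - M $$ (i, p i) else 0)"
      unfolding prod[OF p] by (simp add: sign_def)
  qed
  also have "\<dots> = (\<Sum>p | p permutes {0..<n} \<and> card {i. p i \<noteq> i} = k.
       sign p * (\<Prod>i | p i \<noteq> i. - M $$ (i, p i)))"
    by (rule sum.mono_neutral_cong_right) (auto simp: finite_permutations)
  finally show ?thesis .
qed

section \<open>Signed count of permutations moving four points\<close>

text \<open>The permutations alternate between \<open>A\<close> and \<open>B\<close> on moved
  points, so each moves two points of \<open>A\<close>; marking one of them produces the factor 2.
  Marked even permutations correspond to ordered 2-matchings, marked odd ones to those 2-matchings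
  whose two cross pairs also lie in \<open>R\<close>. The difference counts the nonsingular
  pairs.\<close>

lemma sum_sign_four_point_permutations:
  fixes R :: "('a \<times> 'a) set"
  assumes fin: "finite A" "finite B" and disj: "A \<inter> B = {}" and R: "R \<subseteq> A \<times> B"
  shows "2 * (\<Sum>p | p permutes A \<union> B \<and> card {i. p i \<noteq> i} = 4 \<and>
      (\<forall>i. p i \<noteq> i \<longrightarrow> (i, p i) \<in> R \<union> R\<inverse>). sign p) = int (card (nonsingular_pairs R))"
proof -
  define P where "P = {p. p permutes A \<union> B \<and> card {i. p i \<noteq> i} = 4 \<and>
      (\<forall>i. p i \<noteq> i \<longrightarrow> (i, p i) \<in> R \<union> R\<inverse>)}"
  define T where "T = {((x, y), (x', y')). (x, y) \<in> R \<and> (x', y') \<in> R \<and> x \<noteq> x' \<and> y \<noteq> y'}"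
  define C where "C = {((x, y), (x', y')). (x, y) \<in> R \<and> (x', y') \<in> R \<and> x \<noteq> x' \<and> y \<noteq> y' \<and>
      (x, y') \<in> R \<and> (x', y) \<in> R}"
  have finR: "finite R" using fin R by (meson finite_SigmaI finite_subset)
  have finP: "finite P"
    by (rule finite_subset[of _ "{p. p permutes A \<union> B}"]) (use fin in \<open>auto simp: P_def finite_permutations\<close>)
  have finT: "finite T" by (rule finite_subset[of _ "R \<times> R"]) (use finR in \<open>auto simp: T_def\<close>)
  have CT: "C \<subseteq> T" by (auto simp: C_def T_def)
  have RX: "x \<in> A" "y \<in> B" "x \<noteq> y" "(y, x) \<notin> R" if "(x, y) \<in> R" for x y
    using that R disj by auto
  have toB: "p x \<in> B" "(x, p x) \<in> R" if "p \<in> P" "x \<in> A" "p x \<noteq> x" for p x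
    using that R disj unfolding P_def by blast+
  have toA: "p y \<in> A" "(p y, y) \<in> R" if "p \<in> P" "y \<in> B" "p y \<noteq> y" for p y
    using that R disj unfolding P_def by blast+
  have injP: "p a = p b \<longleftrightarrow> a = b" if "p \<in> P" for p a b
    using that permutes_inj[of p] by (auto simp: P_def inj_eq)
  \<comment> \<open>\<open>p\<close> injects the moved points of each side into those of the other,
    so the four split evenly.\<close>
  have two: "card {x \<in> A. p x \<noteq> x} = 2 \<and> card {y \<in> B. p y \<noteq> y} = 2" if p: "p \<in> P" for p
  proof -
    let ?MA = "{x \<in> A. p x \<noteq> x}" and ?MB = "{y \<in> B. p y \<noteq> y}"
    have "card ?MA \<le> card ?MB"
    proof (rule card_inj_on_le[of p])
      show "inj_on p ?MA" by (simp add: inj_on_def injP[OF p])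
      show "p ` ?MA \<subseteq> ?MB" using toB[OF p] by (auto simp: injP[OF p])
    qed (use fin in auto)
    moreover have "card ?MB \<le> card ?MA"
    proof (rule card_inj_on_le[of p])
      show "inj_on p ?MB" by (simp add: inj_on_def injP[OF p])
      show "p ` ?MB \<subseteq> ?MA" using toA[OF p] by (auto simp: injP[OF p])
    qed (use fin in auto)
    moreover have "card {i. p i \<noteq> i} = card ?MA + card ?MB"
    proof -
      have "p permutes A \<union> B" using p by (simp add: P_def)
      then have eq: "{i. p i \<noteq> i} = ?MA \<union> ?MB"
        using permutes_not_in[of p "A \<union> B"] by blast
      have "?MA \<inter> ?MB = {}" using disj by blast
      with fin show ?thesis unfolding eq by (intro card_Un_disjoint finite_Collect_conjI) simp_all
    qed
    moreover have "card {i. p i \<noteq> i} = 4" using p unfolding P_def by blast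
    ultimately show ?thesis by linarith
  qed
  define S where "S = (SIGMA p : P. {x \<in> A. p x \<noteq> x})"
  have finS: "finite S" unfolding S_def using finP fin by auto
  \<comment> \<open>The moved points are \<open>x, x' \<in> A\<close> and \<open>y, y' \<in> B\<close>, so \<open>p\<close> is a product of two transpositions
    (even) or a 4-cycle (odd). The marked point \<open>x\<close> of a pair in \<open>S\<close> orders \<open>x, x'\<close>.\<close>
  have shape: "\<exists>y x' y'. (x, y) \<in> R \<and> (x', y') \<in> R \<and> x \<noteq> x' \<and> y \<noteq> y' \<and> p x = y \<and> p x' = y' \<and>
      (p y = x \<and> p y' = x' \<or> p y = x' \<and> p y' = x \<and> (x, y') \<in> R \<and> (x', y) \<in> R) \<and>
      (\<forall>z. z \<notin> {x, y, x', y'} \<longrightarrow> p z = z)" if "(p, x) \<in> S" for p x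
  proof -
    have p: "p \<in> P" and x: "x \<in> A" "p x \<noteq> x" using that by (auto simp: S_def)
    have "x \<in> {a \<in> A. p a \<noteq> a}" using x by simp
    moreover obtain u v where "{a \<in> A. p a \<noteq> a} = {u, v}" "u \<noteq> v"
      using two[OF p] card_2_iff by metis
    ultimately obtain x' where x': "{a \<in> A. p a \<noteq> a} = {x, x'}" "x \<noteq> x'"
      by (metis insertE insert_commute singletonD)
    have x'2: "x' \<in> A" "p x' \<noteq> x'" using x'(1) by blast+
    note b = toB[OF p x] toB[OF p x'2]
    have ne: "p x \<noteq> p x'" using x'(2) injP[OF p] by simp
    have my: "p (p x) \<noteq> p x" "p (p x') \<noteq> p x'" using x x'2 injP[OF p] by simp_all
    have "{p x, p x'} = {b \<in> B. p b \<noteq> b}"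
      by (rule card_subset_eq) (use two[OF p] fin b my ne in auto)
    then have MB: "{b \<in> B. p b \<noteq> b} = {p x, p x'}" by simp
    have fixed: "p z = z" if "z \<notin> {x, p x, x', p x'}" for z
    proof (cases "z \<in> A \<union> B")
      case True
      then show ?thesis using that x'(1) MB by blast
    next
      case False
      then show ?thesis using p permutes_not_in by (fastforce simp: P_def)
    qed
    note c = toA[OF p b(1) my(1)] toA[OF p b(3) my(2)]
    have "p (p x) \<in> {a \<in> A. p a \<noteq> a}" "p (p x') \<in> {a \<in> A. p a \<noteq> a}"
      using c my injP[OF p] by simp_all
    then have "p (p x) = x \<or> p (p x) = x'" "p (p x') = x \<or> p (p x') = x'"
      unfolding x'(1) by simp_all
    moreover have "p (p x) \<noteq> p (p x')" using ne injP[OF p] by simp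
    ultimately have "p (p x) = x \<and> p (p x') = x' \<or>
        p (p x) = x' \<and> p (p x') = x \<and> (x, p x') \<in> R \<and> (x', p x) \<in> R"
      using c by metis
    then show ?thesis using b x'(2) ne fixed by blast
  qed
  have in_S: "(p, x) \<in> S"
    if "p permutes A \<union> B" "(x, y) \<in> R" "(x', y') \<in> R" "x \<noteq> x'" "y \<noteq> y'" "p x = y" "p x' = y'"
      "p y = x \<and> p y' = x' \<or> p y = x' \<and> p y' = x \<and> (x, y') \<in> R \<and> (x', y) \<in> R"
      "\<And>z. z \<notin> {x, y, x', y'} \<Longrightarrow> p z = z" for p x y x' y'
  proof -
    note T = that
    have d: "distinct [x, y, x', y']" using RX[OF that(2)] RX[OF that(3)] that(4,5) disj by auto
    have "p x \<noteq> x" "p x' \<noteq> x'" using d by (auto simp: T(6,7))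
    moreover have "p y \<noteq> y" "p y' \<noteq> y'"
      using T(8) d by auto
    ultimately have "{i. p i \<noteq> i} = {x, y, x', y'}" using T(9) by blast
    moreover have "card {x, y, x', y'} = 4" using d by simp
    moreover have "(i, p i) \<in> R \<union> R\<inverse>" if i: "p i \<noteq> i" for i
    proof -
      have "(x, p x) \<in> R" "(x', p x') \<in> R" using T(2,3) by (simp_all add: T(6,7))
      moreover have "(p y, y) \<in> R" "(p y', y') \<in> R"
        using T(8) by (elim disjE conjE; simp add: T(2,3))+
      moreover have "i = x \<or> i = y \<or> i = x' \<or> i = y'" using T(9)[of i] i by blast
      ultimately show ?thesis by blast
    qed
    ultimately have "p \<in> P" using that(1) by (simp add: P_def)
    then show ?thesis using RX[OF that(2)] that(6) by (simp add: S_def)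
  qed
  \<comment> \<open>A marked permutation determines its matching: \<open>x'\<close> is the only
    other moved point of \<open>A\<close>, and \<open>y\<close>, \<open>y'\<close> are the images.
    This serves the injectivity of both \<open>f\<close> and \<open>g\<close>.\<close>
  have determined: "y1 = y2 \<and> x1' = x2' \<and> y1' = y2'"
    if "(x, y1) \<in> R" "(x1', y1') \<in> R" "x \<noteq> x1'" "(x, y2) \<in> R" "(x2', y2') \<in> R" "x \<noteq> x2'"
      and p: "p x = y1" "p x1' = y1'" "p x = y2" "p x2' = y2'"
      and fixed: "\<And>z. z \<notin> {x, y2, x2', y2'} \<Longrightarrow> p z = z" for p x y1 x1' y1' y2 x2' y2'
  proof -
    have "x1' = x2'"
    proof (rule ccontr)
      assume "x1' \<noteq> x2'"
      moreover have "x1' \<noteq> y2" "x1' \<noteq> y2'" using that(2,4,5) R disj by blast+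
      ultimately have "p x1' = x1'" using fixed that(3) by simp
      then show False using RX[OF that(2)] p(2) by simp
    qed
    then show ?thesis using p by simp
  qed
  \<comment> \<open>\<open>f\<close> gives the product of the two transpositions along the matching,
    of sign 1. \<open>g\<close> is a product of three transpositions, hence odd, namely the cycle
    sending \<open>x\<close> to \<open>y\<close>, \<open>y\<close> to \<open>x'\<close>,
    \<open>x'\<close> to \<open>y'\<close> and \<open>y'\<close> to \<open>x\<close>.\<close>
  define f where "f = (\<lambda>((x, y), (x', y')). (transpose x y \<circ> transpose x' y', x :: 'a))"
  define g where "g = (\<lambda>((x, y), (x', y')).
      (transpose x y \<circ> (transpose y x' \<circ> transpose x' y'), x :: 'a))"
  have f_eval: "(transpose x y \<circ> transpose x' y') permutes A \<union> B"
      "(transpose x y \<circ> transpose x' y') x = y" "(transpose x y \<circ> transpose x' y') y = x"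
      "(transpose x y \<circ> transpose x' y') x' = y'" "(transpose x y \<circ> transpose x' y') y' = x'"
      "\<And>z. z \<notin> {x, y, x', y'} \<Longrightarrow> (transpose x y \<circ> transpose x' y') z = z"
    if "((x, y), (x', y')) \<in> T" for x y x' y'
  proof -
    have t: "(x, y) \<in> R" "(x', y') \<in> R" "x \<noteq> x'" "y \<noteq> y'" using that by (auto simp: T_def)
    have d: "distinct [x, y, x', y']" "x \<in> A" "y \<in> B" "x' \<in> A" "y' \<in> B"
      using RX[OF t(1)] RX[OF t(2)] t(3,4) disj by auto
    show "(transpose x y \<circ> transpose x' y') permutes A \<union> B"
      using d by (intro permutes_compose permutes_swap_id) auto
    show "(transpose x y \<circ> transpose x' y') x = y" "(transpose x y \<circ> transpose x' y') y = x"
      "(transpose x y \<circ> transpose x' y') x' = y'" "(transpose x y \<circ> transpose x' y') y' = x'"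
      "\<And>z. z \<notin> {x, y, x', y'} \<Longrightarrow> (transpose x y \<circ> transpose x' y') z = z"
      using d by (auto simp: transpose_def)
  qed
  have g_eval: "(transpose x y \<circ> (transpose y x' \<circ> transpose x' y')) permutes A \<union> B"
      "(transpose x y \<circ> (transpose y x' \<circ> transpose x' y')) x = y"
      "(transpose x y \<circ> (transpose y x' \<circ> transpose x' y')) y = x'"
      "(transpose x y \<circ> (transpose y x' \<circ> transpose x' y')) x' = y'"
      "(transpose x y \<circ> (transpose y x' \<circ> transpose x' y')) y' = x"
      "\<And>z. z \<notin> {x, y, x', y'} \<Longrightarrow> (transpose x y \<circ> (transpose y x' \<circ> transpose x' y')) z = z"
    if "((x, y), (x', y')) \<in> T" for x y x' y'
  proof -
    have t: "(x, y) \<in> R" "(x', y') \<in> R" "x \<noteq> x'" "y \<noteq> y'" using that by (auto simp: T_def)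
    have d: "distinct [x, y, x', y']" "x \<in> A" "y \<in> B" "x' \<in> A" "y' \<in> B"
      using RX[OF t(1)] RX[OF t(2)] t(3,4) disj by auto
    show "(transpose x y \<circ> (transpose y x' \<circ> transpose x' y')) permutes A \<union> B"
      using d by (intro permutes_compose permutes_swap_id) auto
    show "(transpose x y \<circ> (transpose y x' \<circ> transpose x' y')) x = y"
      "(transpose x y \<circ> (transpose y x' \<circ> transpose x' y')) y = x'"
      "(transpose x y \<circ> (transpose y x' \<circ> transpose x' y')) x' = y'"
      "(transpose x y \<circ> (transpose y x' \<circ> transpose x' y')) y' = x"
      "\<And>z. z \<notin> {x, y, x', y'} \<Longrightarrow> (transpose x y \<circ> (transpose y x' \<circ> transpose x' y')) z = z"
      using d by (auto simp: transpose_def)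
  qed
  have inj: "inj_on h U"
    if "U \<subseteq> T" and "\<And>x y x' y'. ((x, y), (x', y')) \<in> U \<Longrightarrow> snd (h ((x, y), (x', y'))) = x \<and>
        fst (h ((x, y), (x', y'))) x = y \<and> fst (h ((x, y), (x', y'))) x' = y' \<and>
        (\<forall>z. z \<notin> {x, y, x', y'} \<longrightarrow> fst (h ((x, y), (x', y'))) z = z)"
    for h :: "('a \<times> 'a) \<times> ('a \<times> 'a) \<Rightarrow> ('a \<Rightarrow> 'a) \<times> 'a" and U
  proof (rule inj_onI)
    fix s t assume "s \<in> U" "t \<in> U" and eq: "h s = h t"
    moreover obtain x y x' y' where s: "s = ((x, y), (x', y'))" by (metis prod.exhaust)
    moreover obtain a b a' b' where t: "t = ((a, b), (a', b'))" by (metis prod.exhaust)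
    ultimately have U: "((x, y), (x', y')) \<in> U" "((a, b), (a', b')) \<in> U" by simp_all
    note hs = that(2)[OF U(1), folded s] and ht = that(2)[OF U(2), folded t]
    have "a = x" using hs ht eq by simp
    moreover have "(x, y) \<in> R" "(x', y') \<in> R" "x \<noteq> x'" "(a, b) \<in> R" "(a', b') \<in> R" "a \<noteq> a'"
      using U that(1) by (auto simp: T_def)
    ultimately have "y = b \<and> x' = a' \<and> y' = b'"
      using hs ht eq by (intro determined[of x y x' y' b a' b' "fst (h s)"]) auto
    then show "s = t" using \<open>a = x\<close> s t by simp
  qed
  have f: "bij_betw f T {(p, x). (p, x) \<in> S \<and> p (p x) = x}"
    unfolding bij_betw_def
  proof
    show "inj_on f T"
      by (rule inj) (simp_all add: f_def f_eval del: comp_apply)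
    show "f ` T = {(p, x). (p, x) \<in> S \<and> p (p x) = x}"
    proof (rule equalityI; rule subsetI)
      fix w assume "w \<in> f ` T"
      then obtain x y x' y' where t: "((x, y), (x', y')) \<in> T" and w: "w = f ((x, y), (x', y'))"
        by (metis imageE prod.exhaust)
      have r: "(x, y) \<in> R" "(x', y') \<in> R" "x \<noteq> x'" "y \<noteq> y'" using t by (auto simp: T_def)
      have "(transpose x y \<circ> transpose x' y', x) \<in> S"
        by (rule in_S[OF f_eval(1)[OF t] r f_eval(2,4)[OF t] _ f_eval(6)[OF t]])
          (use f_eval(3,5)[OF t] in blast)+
      then show "w \<in> {(p, x). (p, x) \<in> S \<and> p (p x) = x}"
        using f_eval[OF t] by (simp add: w f_def del: comp_apply)
    next
      fix w assume "w \<in> {(p, x). (p, x) \<in> S \<and> p (p x) = x}"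
      then obtain p x where w: "w = (p, x)" "(p, x) \<in> S" "p (p x) = x" by blast
      from shape[OF w(2)] obtain y x' y' where h: "(x, y) \<in> R" "(x', y') \<in> R" "x \<noteq> x'" "y \<noteq> y'"
        "p x = y" "p x' = y'" "p y = x \<and> p y' = x' \<or> p y = x' \<and> p y' = x"
        "\<forall>z. z \<notin> {x, y, x', y'} \<longrightarrow> p z = z" by blast
      have h7: "p y = x" "p y' = x'" using h(3,5,7) w(3) by auto
      have t: "((x, y), (x', y')) \<in> T" using h(1-4) by (simp add: T_def)
      have "p = transpose x y \<circ> transpose x' y'"
      proof
        fix z
        note e = f_eval[OF t]
        consider "z = x" | "z = y" | "z = x'" | "z = y'" | "z \<notin> {x, y, x', y'}" by blast
        then show "p z = (transpose x y \<circ> transpose x' y') z"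
        proof cases
          case 5
          then show ?thesis using e(6) h(8) by metis
        qed (simp_all only: e(2-5) h(5,6) h7)
      qed
      then have "w = f ((x, y), (x', y'))" by (simp add: f_def w)
      then show "w \<in> f ` T" using t by blast
    qed
  qed
  have g: "bij_betw g C {(p, x). (p, x) \<in> S \<and> p (p x) \<noteq> x}"
    unfolding bij_betw_def
  proof
    show "inj_on g C"
      by (rule inj[OF CT]) (simp add: g_def g_eval[OF subsetD[OF CT]] del: comp_apply)
    show "g ` C = {(p, x). (p, x) \<in> S \<and> p (p x) \<noteq> x}"
    proof (rule equalityI; rule subsetI)
      fix w assume "w \<in> g ` C"
      then obtain x y x' y' where tC: "((x, y), (x', y')) \<in> C" and w: "w = g ((x, y), (x', y'))"
        by (metis imageE prod.exhaust)
      note t = subsetD[OF CT tC]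
      have r: "(x, y) \<in> R" "(x', y') \<in> R" "x \<noteq> x'" "y \<noteq> y'" "(x, y') \<in> R" "(x', y) \<in> R"
        using tC by (auto simp: C_def)
      have "(transpose x y \<circ> (transpose y x' \<circ> transpose x' y'), x) \<in> S"
        by (rule in_S[OF g_eval(1)[OF t] r(1-4) g_eval(2,4)[OF t] _ g_eval(6)[OF t]])
          (use g_eval(3,5)[OF t] r in blast)+
      then show "w \<in> {(p, x). (p, x) \<in> S \<and> p (p x) \<noteq> x}"
        using g_eval[OF t] r(3) by (simp add: w g_def del: comp_apply)
    next
      fix w assume "w \<in> {(p, x). (p, x) \<in> S \<and> p (p x) \<noteq> x}"
      then obtain p x where w: "w = (p, x)" "(p, x) \<in> S" "p (p x) \<noteq> x" by blast
      from shape[OF w(2)] obtain y x' y' where h: "(x, y) \<in> R" "(x', y') \<in> R" "x \<noteq> x'" "y \<noteq> y'"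
        "p x = y" "p x' = y'"
        "p y = x \<and> p y' = x' \<or> p y = x' \<and> p y' = x \<and> (x, y') \<in> R \<and> (x', y) \<in> R"
        "\<forall>z. z \<notin> {x, y, x', y'} \<longrightarrow> p z = z" by blast
      have h7: "p y = x'" "p y' = x" "(x, y') \<in> R" "(x', y) \<in> R" using h(5,7) w(3) by auto
      have tC: "((x, y), (x', y')) \<in> C" using h(1-4) h7 by (simp add: C_def)
      note t = subsetD[OF CT tC]
      have "p = transpose x y \<circ> (transpose y x' \<circ> transpose x' y')"
      proof
        fix z
        note e = g_eval[OF t]
        consider "z = x" | "z = y" | "z = x'" | "z = y'" | "z \<notin> {x, y, x', y'}" by blast
        then show "p z = (transpose x y \<circ> (transpose y x' \<circ> transpose x' y')) z"
        proof cases
          case 5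
          then show ?thesis using e(6) h(8) by metis
        qed (simp_all only: e(2-5) h(5,6) h7)
      qed
      then have "w = g ((x, y), (x', y'))" by (simp add: g_def w)
      then show "w \<in> g ` C" using tC by blast
    qed
  qed
  have "2 * (\<Sum>p\<in>P. sign p) = (\<Sum>p\<in>P. \<Sum>x | x \<in> A \<and> p x \<noteq> x. sign p)"
    using two by (simp add: sum_distrib_left)
  also have "\<dots> = (\<Sum>(p, x)\<in>S. sign p)"
    unfolding S_def using finP fin by (subst sum.Sigma) auto
  also have "S = {(p, x). (p, x) \<in> S \<and> p (p x) = x} \<union> {(p, x). (p, x) \<in> S \<and> p (p x) \<noteq> x}"
    by auto
  also have "(\<Sum>(p, x)\<in>\<dots>. sign p) = (\<Sum>(p, x) | (p, x) \<in> S \<and> p (p x) = x. sign p) +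
      (\<Sum>(p, x) | (p, x) \<in> S \<and> p (p x) \<noteq> x. sign p)"
    by (rule sum.union_disjoint) (auto intro: finite_subset[OF _ finS])
  also have "(\<Sum>(p, x) | (p, x) \<in> S \<and> p (p x) = x. sign p) = int (card T)"
  proof -
    have "(\<Sum>(p, x) | (p, x) \<in> S \<and> p (p x) = x. sign p) = (\<Sum>t\<in>T. case f t of (p, x) \<Rightarrow> sign p)"
      by (rule sum.reindex_bij_betw[OF f, symmetric])
    also have "\<dots> = (\<Sum>t\<in>T. 1)"
      by (rule sum.cong) (auto simp: f_def T_def sign_compose permutation_swap_id sign_swap_id dest: RX)
    finally show ?thesis by simp
  qed
  also have "(\<Sum>(p, x) | (p, x) \<in> S \<and> p (p x) \<noteq> x. sign p) = - int (card C)"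
  proof -
    have "(\<Sum>(p, x) | (p, x) \<in> S \<and> p (p x) \<noteq> x. sign p) = (\<Sum>t\<in>C. case g t of (p, x) \<Rightarrow> sign p)"
      by (rule sum.reindex_bij_betw[OF g, symmetric])
    also have "\<dots> = (\<Sum>t\<in>C. - 1)"
      by (rule sum.cong)
        (auto simp: g_def C_def sign_compose permutation_swap_id permutation_compose sign_swap_id dest: RX)
    finally show ?thesis by simp
  qed
  also have "int (card T) + - int (card C) = int (card (nonsingular_pairs R))"
  proof -
    have "nonsingular_pairs R = T - C" by (auto simp: nonsingular_pairs_def T_def C_def)
    then show ?thesis
      using finT CT by (simp add: card_Diff_subset finite_subset card_mono of_nat_diff)
  qed
  finally show ?thesis unfolding P_def .
qed

section \<open>Bipartite graphs\<close>

definition bip_graph :: "'a set \<Rightarrow> 'a set \<Rightarrow> ('a \<times> 'a) set \<Rightarrow> 'a pair_pre_digraph" where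
  "bip_graph X Y E = \<lparr>pverts = X \<union> Y, parcs = E \<union> E\<inverse>\<rparr>"

lemma bip_graph_simps [simp]:
  "pverts (bip_graph X Y E) = X \<union> Y" "parcs (bip_graph X Y E) = E \<union> E\<inverse>"
  by (simp_all add: bip_graph_def)

lemma bip_graph_converse: "bip_graph Y X (E\<inverse>) = bip_graph X Y E"
  by (simp add: bip_graph_def Un_commute)

locale bipartition =
  fixes X Y :: "'a set" and E :: "('a \<times> 'a) set"
  assumes fin: "finite X" "finite Y" and disj: "X \<inter> Y = {}" and edges_subset: "E \<subseteq> X \<times> Y"
begin

lemma finite_E: "finite E"
  using fin edges_subset by (meson finite_SigmaI finite_subset)

lemma pair_graph_bip_graph: "pair_graph (bip_graph X Y E)"
proof
  show "Digraph.symmetric (with_proj (bip_graph X Y E))"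
    by (auto simp: symmetric_def sym_def)
qed (use fin finite_E disj edges_subset in auto)

text \<open>Orienting from \<open>X\<close> to \<open>Y\<close> selects exactly one arc of each
  edge, as the sides are disjoint.\<close>

lemma card_edges_bip_graph: "card (edges (bip_graph X Y E)) = card E"
proof -
  have "edges (bip_graph X Y E) = (\<lambda>(u, v). {u, v}) ` E"
    by (force simp: edges_def image_iff)
  moreover have "inj_on (\<lambda>(u, v). {u, v}) E"
    using edges_subset disj by (fastforce simp: inj_on_def doubleton_eq_iff)
  ultimately show ?thesis by (simp add: card_image)
qed

text \<open>A nonempty closed set absorbs everything reachable from it; conversely, the vertices
  reachable from \<open>u\<close> form a closed set. Since \<open>X\<close> is nonempty, so is the
  vertex set, as connectedness demands.\<close>

lemma connected_bip_graph_iff: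
  assumes "X \<noteq> {}"
  shows "Digraph_Component.connected (with_proj (bip_graph X Y E)) \<longleftrightarrow> bip_connected X Y E"
proof
  let ?G = "with_proj (bip_graph X Y E)" and ?R = "E \<union> E\<inverse>"
  have sc: "symcl ?R = ?R" by (auto simp: symcl_def)
  assume "Digraph_Component.connected ?G"
  then have reach: "(u, v) \<in> ?R\<^sup>*" if "u \<in> X \<union> Y" "v \<in> X \<union> Y" for u v
    using that rtrancl_on_rtranclI[of u v "X \<union> Y" ?R] by (auto simp: connected_conv sc)
  show "bip_connected X Y E"
    unfolding bip_connected_def
  proof (intro allI impI)
    fix A B assume A: "A \<subseteq> X" and B: "B \<subseteq> Y" and cl: "\<forall>(x, y)\<in>E. (x \<in> A) = (y \<in> B)"
    have step: "b \<in> A \<union> B" if "(a, b) \<in> ?R" "a \<in> A \<union> B" for a b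
      using that cl edges_subset disj A B by blast
    have "v \<in> A \<union> B" if "u \<in> A \<union> B" "v \<in> X \<union> Y" for u v
    proof -
      have "(u, v) \<in> ?R\<^sup>*" using reach that A B by blast
      then show ?thesis using that(1) by (induction rule: rtrancl_induct) (use step in blast)+
    qed
    then show "A = {} \<and> B = {} \<or> A = X \<and> B = Y"
      using A B disj by blast
  qed
next
  let ?G = "with_proj (bip_graph X Y E)" and ?R = "E \<union> E\<inverse>"
  assume con: "bip_connected X Y E"
  interpret pair_graph "bip_graph X Y E" by (rule pair_graph_bip_graph)
  have sc: "symcl ?R = ?R" by (auto simp: symcl_def)
  have "(u, v) \<in> rtrancl_on (X \<union> Y) ?R" if u: "u \<in> X \<union> Y" and v: "v \<in> X \<union> Y" for u v
  proof -
    define S where "S = {w \<in> X \<union> Y. (u, w) \<in> rtrancl_on (X \<union> Y) ?R}"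
    have step: "b \<in> S" if "a \<in> S" "(a, b) \<in> ?R" for a b
      using that edges_subset unfolding S_def by (blast intro: rtrancl_on_into_rtrancl_on)
    have "u \<in> S" using u unfolding S_def by auto
    have "(S \<inter> X = {} \<and> S \<inter> Y = {}) \<or> (S \<inter> X = X \<and> S \<inter> Y = Y)"
    proof (rule bip_connectedD[OF con])
      fix x y assume "(x, y) \<in> E"
      then show "x \<in> S \<inter> X \<longleftrightarrow> y \<in> S \<inter> Y"
        using step[of x y] step[of y x] edges_subset by blast
    qed auto
    then have "v \<in> S" using \<open>u \<in> S\<close> u v by blast
    then show ?thesis by (simp add: S_def)
  qed
  then show "Digraph_Component.connected ?G"
    using assms by (simp add: connected_conv sc)
qed

text \<open>For four moved points the product of the negated entries is 1 if all moves follow arcs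
  and 0 otherwise, so the coefficient is a sum of signs. It is evaluated on the indices of the
  enumeration \<open>vs\<close> and then carried over to the vertices.\<close>

lemma char_coeff_4_bip_graph:
  assumes "card X + card Y \<ge> 4"
  shows "2 * char_coeff 4 (bip_graph X Y E) = int (card (nonsingular_pairs E))"
proof -
  let ?G = "bip_graph X Y E"
  define vs where "vs = (SOME vs. distinct vs \<and> set vs = pverts ?G)"
  have "\<exists>vs. distinct vs \<and> set vs = pverts ?G"
    using finite_distinct_list[of "X \<union> Y"] fin by auto
  from someI_ex[OF this, folded vs_def] have vs: "distinct vs" "set vs = X \<union> Y"
    by simp_all
  define n where "n = length vs"
  have n: "card (X \<union> Y) = n" "n \<ge> 4"
    using distinct_card[OF vs(1)] vs(2) card_Un_disjoint[OF fin disj] assms by (simp_all add: n_def)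
  define A where "A = {i. i < n \<and> vs ! i \<in> X}"
  define B where "B = {i. i < n \<and> vs ! i \<in> Y}"
  define R where "R = {(i, j). i < n \<and> j < n \<and> (vs ! i, vs ! j) \<in> E}"
  have AB: "finite A" "finite B" "A \<inter> B = {}" "R \<subseteq> A \<times> B"
    using disj edges_subset by (auto simp: A_def B_def R_def)
  have "vs ! i \<in> X \<union> Y" if "i < n" for i
    using nth_mem[of i vs] that unfolding vs(2) n_def by blast
  then have ABn: "A \<union> B = {0..<n}" unfolding A_def B_def atLeast0LessThan lessThan_def by blast
  define M where "M = adjacency_matrix ?G vs"
  have M: "M \<in> carrier_mat n n" by (simp add: M_def adjacency_matrix_def n_def)
  have M_entry: "M $$ (i, j) = (if (i, j) \<in> R \<union> R\<inverse> then 1 else 0)" if "i < n" "j < n" for i j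
    using that by (auto simp: M_def adjacency_matrix_def n_def R_def)
  have M_diag: "M $$ (i, i) = 0" if "i < n" for i
    using that M_entry[of i i] AB(3,4) by auto
  let ?arcs = "\<lambda>p. \<forall>i. p i \<noteq> i \<longrightarrow> (i, p i) \<in> R \<union> R\<inverse>"
  have "char_coeff 4 ?G = coeff (char_poly M) (n - 4)"
    unfolding char_coeff_def graph_char_poly_def M_def vs_def[symmetric] by (simp add: n(1))
  also have "\<dots> = (\<Sum>p | p permutes {0..<n} \<and> card {i. p i \<noteq> i} = 4.
       sign p * (\<Prod>i | p i \<noteq> i. - M $$ (i, p i)))"
    by (rule coeff_char_poly_zero_diagonal[OF M M_diag n(2)])
  also have "\<dots> = (\<Sum>p | p permutes {0..<n} \<and> card {i. p i \<noteq> i} = 4 \<and> ?arcs p. sign p)"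
  proof (rule sum.mono_neutral_cong_right)
    show "finite {p. p permutes {0..<n} \<and> card {i. p i \<noteq> i} = 4}"
      by (rule finite_subset[of _ "{p. p permutes {0..<n}}"]) (auto simp: finite_permutations)
    have bound: "i < n" "p i < n" if "p permutes {0..<n}" "p i \<noteq> i" for p i
      using permutes_not_in[OF that(1), of i] permutes_in_image[OF that(1), of i] that(2) by auto
    show "\<forall>p\<in>{p. p permutes {0..<n} \<and> card {i. p i \<noteq> i} = 4} -
        {p. p permutes {0..<n} \<and> card {i. p i \<noteq> i} = 4 \<and> ?arcs p}.
        sign p * (\<Prod>i | p i \<noteq> i. - M $$ (i, p i)) = 0"
    proof
      fix p assume "p \<in> {p. p permutes {0..<n} \<and> card {i. p i \<noteq> i} = 4} -
        {p. p permutes {0..<n} \<and> card {i. p i \<noteq> i} = 4 \<and> ?arcs p}"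
      then have p: "p permutes {0..<n}" "card {i. p i \<noteq> i} = 4" and "\<not> ?arcs p" by blast+
      then obtain i where i: "p i \<noteq> i" "(i, p i) \<notin> R \<union> R\<inverse>" by blast
      have "finite {i. p i \<noteq> i}" using p(2) card.infinite by fastforce
      moreover have "- M $$ (i, p i) = 0" using M_entry[OF bound[OF p(1) i(1)]] i(2) by simp
      ultimately have "(\<Prod>i | p i \<noteq> i. - M $$ (i, p i)) = 0"
        using i(1) by (intro prod_zero) auto
      then show "sign p * (\<Prod>i | p i \<noteq> i. - M $$ (i, p i)) = 0" by simp
    qed
    show "sign p * (\<Prod>i | p i \<noteq> i. - M $$ (i, p i)) = sign p"
      if "p \<in> {p. p permutes {0..<n} \<and> card {i. p i \<noteq> i} = 4 \<and> ?arcs p}" for p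
    proof -
      have p: "p permutes {0..<n}" "card {i. p i \<noteq> i} = 4" "?arcs p" using that by blast+
      have "(\<Prod>i | p i \<noteq> i. - M $$ (i, p i)) = (\<Prod>i | p i \<noteq> i. - 1)"
        by (rule prod.cong[OF refl]) (use M_entry[OF bound[OF p(1)]] p(3) in simp)
      also have "\<dots> = 1" using p(2) by simp
      finally show ?thesis by simp
    qed
  qed blast
  also have "2 * \<dots> = int (card (nonsingular_pairs R))"
    using sum_sign_four_point_permutations[OF AB] unfolding ABn .
  also have "card (nonsingular_pairs R) = card (nonsingular_pairs (map_prod ((!) vs) ((!) vs) ` R))"
  proof (rule card_nonsingular_pairs_image[symmetric])
    show "inj_on ((!) vs) {..<n}" "inj_on ((!) vs) {..<n}"
      by (auto simp: inj_on_def n_def nth_eq_iff_index_eq[OF vs(1)])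
    show "R \<subseteq> {..<n} \<times> {..<n}" by (auto simp: R_def)
  qed
  also have "map_prod ((!) vs) ((!) vs) ` R = E"
  proof (rule equalityI; rule subsetI)
    fix e assume e: "e \<in> E"
    then have "fst e \<in> set vs" "snd e \<in> set vs" using edges_subset vs(2) by auto
    then obtain i j where "i < n" "j < n" "vs ! i = fst e" "vs ! j = snd e"
      by (auto simp: in_set_conv_nth n_def)
    then have "(i, j) \<in> R" "e = map_prod ((!) vs) ((!) vs) (i, j)"
      using e by (simp_all add: R_def)
    then show "e \<in> map_prod ((!) vs) ((!) vs) ` R" by (rule image_eqI[rotated])
  qed (auto simp: R_def)
  finally show ?thesis .
qed

lemma bip_graph_in_connected_bipartite_graphs:
  assumes "bip_connected X Y E" "X \<noteq> {}" 
  shows "bip_graph X Y E \<in> connected_bipartite_graphs (card X + card Y) (card E)"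
proof -
  have "bipartite (bip_graph X Y E)"
    unfolding bipartite_def using disj edges_subset by (intro exI[of _ X] exI[of _ Y]) auto
  then show ?thesis
    using assms pair_graph_bip_graph connected_bip_graph_iff card_edges_bip_graph
      card_Un_disjoint[OF fin disj]
    by (simp add: connected_bipartite_graphs_def)
qed

end

text \<open>A positive number of edges makes \<open>X\<close> nonempty, which the characterisation
  of connectivity requires.\<close>

lemma connected_bipartite_graphsE:
  assumes G: "G \<in> connected_bipartite_graphs n m" and "m > 0"
  obtains X Y E where "G = bip_graph X Y E" "bipartition X Y E" "bip_connected X Y E"
    "card X + card Y = n" "card E = m"
proof -
  interpret pair_graph G using G by (simp add: connected_bipartite_graphs_def)
  obtain X Y where XY: "X \<union> Y = pverts G" "X \<inter> Y = {}" "parcs G \<subseteq> X \<times> Y \<union> Y \<times> X"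
    using G by (auto simp: connected_bipartite_graphs_def bipartite_def)
  define E where "E = parcs G \<inter> X \<times> Y"
  have sym: "(v, u) \<in> parcs G" if "(u, v) \<in> parcs G" for u v
    using that pair_sym_arcs by (auto simp: symmetric_def sym_def)
  have "parcs G = E \<union> E\<inverse>"
    using XY(3) sym unfolding E_def by blast
  then have eq: "G = bip_graph X Y E"
    using XY(1) by (simp add: bip_graph_def)
  have part: "bipartition X Y E"
    using XY pair_finite_verts by unfold_locales (auto simp: E_def intro: finite_subset[of _ "pverts G"])
  interpret bipartition X Y E by (rule part)
  have card: "card E = m"
    using G card_edges_bip_graph by (simp add: connected_bipartite_graphs_def eq)
  then have "X \<noteq> {}" using \<open>m > 0\<close> edges_subset by auto
  then have "bip_connected X Y E"
    using G connected_bip_graph_iff by (simp add: connected_bipartite_graphs_def eq)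
  moreover have "card X + card Y = n"
    using G card_Un_disjoint[OF fin disj] by (simp add: connected_bipartite_graphs_def eq)
  ultimately show ?thesis using that eq part card by blast
qed

lemma digraph_iso_bip_graph_image:
  assumes "bipartition X Y E" and inj: "inj_on f (X \<union> Y)"
  shows "digraph_iso (with_proj (bip_graph X Y E))
    (with_proj (bip_graph (f ` X) (f ` Y) (map_prod f f ` E)))"
proof -
  interpret bipartition X Y E by (rule assms)
  let ?G = "bip_graph X Y E"
  let ?f = "\<lparr>iso_verts = f, iso_arcs = map_prod f f, iso_head = snd, iso_tail = fst\<rparr>"
  interpret G: pair_graph ?G by (rule pair_graph_bip_graph)
  have "inj_on (map_prod f f) (E \<union> E\<inverse>)"
    by (rule inj_on_subset[OF map_prod_inj_on[OF inj inj]]) (use edges_subset in auto)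
  then have "pre_digraph.digraph_isomorphism (with_proj ?G) ?f"
    unfolding pre_digraph.digraph_isomorphism_def
    using inj G.wf_digraph_axioms by simp
  moreover have "map_prod f f ` (E \<union> E\<inverse>) = map_prod f f ` E \<union> (map_prod f f ` E)\<inverse>"
    by force
  then have "with_proj (bip_graph (f ` X) (f ` Y) (map_prod f f ` E)) = app_iso ?f (with_proj ?G)"
    by (simp add: app_iso_def with_proj_def image_Un)
  ultimately show ?thesis unfolding digraph_iso_def by blast
qed

section \<open>The extremal graph\<close>

text \<open>A biadjacency matrix with a full row \<open>u\<close> and a row \<open>u'\<close>
  supported on \<open>Z\<close>. The claimed graph has this form with \<open>t\<close> columns in
  \<open>Z\<close> and \<open>s\<close> outside it.\<close>

definition two_row :: "'a \<Rightarrow> 'a \<Rightarrow> 'b set \<Rightarrow> 'b set \<Rightarrow> ('a \<times> 'b) set" where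
  "two_row u u' Y Z = {u} \<times> Y \<union> {u'} \<times> Z"

lemma card_two_row:
  assumes "u \<noteq> u'" "finite Y" "Z \<subseteq> Y"
  shows "card (two_row u u' Y Z) = card Y + card Z"
  unfolding two_row_def using assms finite_subset[OF assms(3,2)]
  by (subst card_Un_disjoint) auto

lemma bip_connected_two_row:
  assumes "Z \<subseteq> Y" "Z \<noteq> {}"
  shows "bip_connected {u, u'} Y (two_row u u' Y Z)"
  unfolding bip_connected_def
proof (intro allI impI)
  fix A B
  assume A: "A \<subseteq> {u, u'}" and B: "B \<subseteq> Y" and cl: "\<forall>(x, y)\<in>two_row u u' Y Z. (x \<in> A) = (y \<in> B)"
  have "u \<in> A \<longleftrightarrow> y \<in> B" if "y \<in> Y" for y using cl that by (auto simp: two_row_def)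
  moreover have "u' \<in> A \<longleftrightarrow> y \<in> B" if "y \<in> Z" for y using cl that by (auto simp: two_row_def)
  ultimately show "A = {} \<and> B = {} \<or> A = {u, u'} \<and> B = Y"
    using assms A B by blast
qed

text \<open>A nonsingular minor takes one column from \<open>Z\<close> and one from
  \<open>Y - Z\<close>; the order of the pair doubles the count.\<close>

lemma card_nonsingular_pairs_two_row:
  assumes "u \<noteq> u'" "finite Y" "Z \<subseteq> Y"
  shows "card (nonsingular_pairs (two_row u u' Y Z)) = 2 * (card Z * card (Y - Z))"
proof -
  let ?D = "(Y - Z) \<times> Z"
  have "nonsingular_pairs (two_row u u' Y Z) =
      (\<lambda>(y, z). ((u, y), (u', z))) ` ?D \<union> (\<lambda>(y, z). ((u', z), (u, y))) ` ?D" (is "_ = ?A \<union> ?B")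
    using assms(1,3) by (auto simp: nonsingular_pairs_def two_row_def image_iff)
  moreover have "?A \<inter> ?B = {}" using assms(1) by auto
  moreover have "finite ?D" using assms finite_subset by auto
  moreover have "card ?A = card ?D" "card ?B = card ?D"
    by (rule card_image; auto simp: inj_on_def)+
  ultimately show ?thesis
    by (simp add: card_Un_disjoint card_cartesian_product mult.commute)
qed

lemma dominating_pairE:
  assumes "dominating_pair X Y E" "E \<subseteq> X \<times> Y"
  obtains u u' Z where "u \<noteq> u'" "X = {u, u'}" "Z \<subseteq> Y" "E = two_row u u' Y Z"
proof -
  obtain u u' where u: "u \<noteq> u'" "X = {u, u'}" "{u} \<times> Y \<subseteq> E"
    using assms(1) unfolding dominating_pair_def by blast
  have "E = two_row u u' Y (E `` {u'})"
    using u assms(2) by (auto simp: two_row_def)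
  moreover have "E `` {u'} \<subseteq> Y" using assms(2) by blast
  ultimately show ?thesis using that u(1,2) by blast
qed

text \<open>Columns within \<open>Z\<close> are interchangeable, and so are those outside it. Hence
  any bijections between corresponding column classes glue to an isomorphism.\<close>

lemma digraph_iso_two_row:
  assumes uw: "u \<noteq> u'" "w \<noteq> w'" and notin: "{u, u'} \<inter> Y = {}" "{w, w'} \<inter> Y' = {}"
    and Z: "Z \<subseteq> Y" "Z' \<subseteq> Y'" and fin: "finite Y" "finite Y'"
    and card: "card Y = card Y'" "card Z = card Z'"
  shows "digraph_iso (with_proj (bip_graph {u, u'} Y (two_row u u' Y Z)))
    (with_proj (bip_graph {w, w'} Y' (two_row w w' Y' Z')))"
proof -
  have finZ: "finite Z" "finite Z'" using Z fin finite_subset by auto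
  have "card (Y - Z) = card (Y' - Z')"
    using card_Diff_subset[OF finZ(1) Z(1)] card_Diff_subset[OF finZ(2) Z(2)] card by simp
  then obtain g where g: "bij_betw g (Y - Z) (Y' - Z')"
    using finite_same_card_bij[of "Y - Z" "Y' - Z'"] fin by blast
  obtain h where h: "bij_betw h Z Z'"
    using finite_same_card_bij[OF finZ card(2)] by blast
  define f where "f x = (if x = u then w else if x = u' then w' else if x \<in> Z then h x else g x)" for x
  have f_Z: "f x = h x" if "x \<in> Z" for x using that Z notin by (auto simp: f_def)
  have f_YZ: "f x = g x" if "x \<in> Y - Z" for x using that notin by (auto simp: f_def)
  have fu: "f u = w" "f u' = w'" using uw by (auto simp: f_def)
  have "bij_betw f Z Z'" using h bij_betw_cong[of Z f h] f_Z by blast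
  moreover have "bij_betw f (Y - Z) (Y' - Z')" using g bij_betw_cong[of "Y - Z" f g] f_YZ by blast
  ultimately have "bij_betw f (Z \<union> (Y - Z)) (Z' \<union> (Y' - Z'))"
    by (rule bij_betw_combine) auto
  then have fY: "bij_betw f Y Y'" using Z by (simp add: Un_absorb1)
  moreover have "bij_betw f {u, u'} {w, w'}"
    using uw fu by (auto simp: bij_betw_def)
  ultimately have "bij_betw f ({u, u'} \<union> Y) ({w, w'} \<union> Y')"
    using notin(2) by (intro bij_betw_combine)
  then have inj: "inj_on f ({u, u'} \<union> Y)" by (rule bij_betw_imp_inj_on)
  have im: "f ` {u, u'} = {w, w'}" "f ` Y = Y'" "f ` Z = Z'"
    using fu fY \<open>bij_betw f Z Z'\<close> by (simp_all add: bij_betw_imp_surj_on)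
  have "map_prod f f ` two_row u u' Y Z = {f u} \<times> f ` Y \<union> {f u'} \<times> f ` Z"
    unfolding two_row_def image_Un by force
  then have "map_prod f f ` two_row u u' Y Z = two_row w w' Y' Z'"
    by (simp add: two_row_def im fu)
  moreover have "bipartition {u, u'} Y (two_row u u' Y Z)"
    using fin notin(1) Z(1) by unfold_locales (auto simp: two_row_def)
  ultimately show ?thesis
    using digraph_iso_bip_graph_image[OF _ inj, of "two_row u u' Y Z"] im by simp
qed

text \<open>Here \<open>k = 2\<close>, so \<open>i + j \<le> 3\<close> joins the first row block to
  both column blocks and the second only to the first. Blocks are numbered from 1 and their members
  from 0.\<close>

lemma difference_graph_eq_bip_graph:
  "difference_graph [1, 1] [t, s] =
    bip_graph {Inl (1, 0), Inl (2, 0)} (Inr ` ({1} \<times> {..<t} \<union> {2} \<times> {..<s}))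
      (two_row (Inl (1, 0)) (Inl (2, 0)) (Inr ` ({1} \<times> {..<t} \<union> {2} \<times> {..<s})) (Inr ` ({1} \<times> {..<t})))"
proof -
  let ?X = "{Inl (i, a) | i a. 1 \<le> i \<and> i \<le> length [1, 1 :: nat] \<and> a < [1, 1] ! (i - 1)} :: (nat \<times> nat + nat \<times> nat) set"
  let ?Y = "{Inr (j, b) | j b. 1 \<le> j \<and> j \<le> length [1, 1 :: nat] \<and> b < [t, s] ! (j - 1)} :: (nat \<times> nat + nat \<times> nat) set"
  let ?E = "{(Inl (i, a), Inr (j, b)) | i a j b. i + j \<le> length [1, 1 :: nat] + 1} \<inter> ?X \<times> ?Y"
  have two: "1 \<le> i \<and> i \<le> length [1, 1 :: nat] \<longleftrightarrow> i = 1 \<or> i = 2" for i by auto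
  have X: "?X = {Inl (1, 0), Inl (2, 0)}"
    unfolding conj_assoc[symmetric] two by auto
  have Y: "?Y = Inr ` ({1} \<times> {..<t} \<union> {2} \<times> {..<s})"
    unfolding conj_assoc[symmetric] two by auto
  have "?E = two_row (Inl (1, 0)) (Inl (2, 0)) (Inr ` ({1} \<times> {..<t} \<union> {2} \<times> {..<s})) (Inr ` ({1} \<times> {..<t}))"
    unfolding X Y by (auto simp: two_row_def)
  then show ?thesis
    unfolding difference_graph_def bip_graph_def Let_def X Y by simp
qed

section \<open>Optimality and uniqueness\<close>

theorem theorem5p2:
  fixes n m :: nat
  assumes "n \<ge> 6" and "n - 1 < m" and "m < 2 * (n - 2)"
  shows "bipartite_optimal n m (difference_graph [1, 1] [m - n + 2, 2 * n - 4 - m]) \<and>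
    (\<forall>G :: 'a pair_pre_digraph. bipartite_optimal n m G \<longrightarrow>
       digraph_iso (with_proj G)
         (with_proj (difference_graph [1, 1] [m - n + 2, 2 * n - 4 - m])))"
proof -
  define t s where "t = m - n + 2" and "s = 2 * n - 4 - m"
  have ts: "t + s = n - 2" "n - 2 + t = m" "t \<ge> 2" "s \<ge> 1" "m > 0"
    using assms by (auto simp: t_def s_def)
  \<comment> \<open>Valid over any vertex type: it is applied to the difference graph itself and,
    for uniqueness, to a competitor over the type of \<open>G\<close>.\<close>
  have two_row: "bipartition {u, u'} Y (two_row u u' Y Z) \<and>
      bip_graph {u, u'} Y (two_row u u' Y Z) \<in> connected_bipartite_graphs n m \<and>
      char_coeff 4 (bip_graph {u, u'} Y (two_row u u' Y Z)) = int (t * s)"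
    if h: "u \<noteq> u'" "finite Y" "Z \<subseteq> Y" "{u, u'} \<inter> Y = {}" "card Y = n - 2" "card Z = t"
    for u u' :: 'b and Y Z
  proof -
    interpret bipartition "{u, u'}" Y "two_row u u' Y Z"
      using h by unfold_locales (auto simp: two_row_def)
    have "Z \<noteq> {}" using h(6) ts(3) by auto
    have "card {u, u'} + card Y = n" using h(1,5) assms(1) by simp
    moreover have "card (two_row u u' Y Z) = m"
      using card_two_row[OF h(1-3)] h(5,6) ts(2) by simp
    moreover have "card (Y - Z) = s"
      using card_Diff_subset[OF finite_subset[OF h(3,2)] h(3)] h(5,6) ts(1) by simp
    ultimately show ?thesis
      using bip_graph_in_connected_bipartite_graphs[OF bip_connected_two_row[OF h(3) \<open>Z \<noteq> {}\<close>]]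
        char_coeff_4_bip_graph card_nonsingular_pairs_two_row[OF h(1-3)] h(6) assms(1)
        bipartition_axioms by simp
  qed
  have bound: "t * s \<le> char_coeff 4 (bip_graph X Y E) \<and>
      (char_coeff 4 (bip_graph X Y E) = t * s \<longrightarrow>
        dominating_pair X Y E \<or> dominating_pair Y X (E\<inverse>))"
    if h: "bipartition X Y E" "bip_connected X Y E" "card X + card Y = n" "card E = m"
    for X Y :: "'b set" and E
  proof -
    interpret bipartition X Y E by (rule h)
    have "2 * int t * int s \<le> int (card (nonsingular_pairs E)) \<and>
      (int (card (nonsingular_pairs E)) = 2 * int t * int s \<longrightarrow>
        dominating_pair X Y E \<or> dominating_pair Y X (E\<inverse>))"
      by (rule card_nonsingular_pairs_ge[OF fin edges_subset h(2)])
        (use h(3,4) assms ts in \<open>auto simp: t_def s_def\<close>)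
    then show ?thesis
      using char_coeff_4_bip_graph h(3) assms(1) by simp
  qed
  let ?u = "Inl (1, 0) :: nat \<times> nat + nat \<times> nat" and ?u' = "Inl (2, 0) :: nat \<times> nat + nat \<times> nat"
  let ?Y = "Inr ` ({1} \<times> {..<t} \<union> {2} \<times> {..<s}) :: (nat \<times> nat + nat \<times> nat) set"
  let ?Z = "Inr ` ({1} \<times> {..<t}) :: (nat \<times> nat + nat \<times> nat) set"
  have D: "difference_graph [1, 1] [t, s] = bip_graph {?u, ?u'} ?Y (two_row ?u ?u' ?Y ?Z)"
    by (rule difference_graph_eq_bip_graph)
  have YZ: "?u \<noteq> ?u'" "finite ?Y" "?Z \<subseteq> ?Y" "{?u, ?u'} \<inter> ?Y = {}" "card ?Y = n - 2" "card ?Z = t"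
  proof -
    have "card ({1} \<times> {..<t} \<union> {2 :: nat} \<times> {..<s}) = t + s"
      by (subst card_Un_disjoint) auto
    then show "card ?Y = n - 2" using ts(1) by (simp add: card_image)
    show "card ?Z = t" by (simp add: card_image)
  qed auto
  have opt: "bipartite_optimal n m (difference_graph [1, 1] [t, s])"
    unfolding bipartite_optimal_def is_arg_min_def
  proof (intro conjI notI)
    show "difference_graph [1, 1] [t, s] \<in> connected_bipartite_graphs n m"
      using two_row[OF YZ] unfolding D by blast
    assume "\<exists>H :: (nat \<times> nat + nat \<times> nat) pair_pre_digraph. H \<in> connected_bipartite_graphs n m \<and>
      char_coeff 4 H < char_coeff 4 (difference_graph [1, 1] [t, s])"
    then obtain H :: "(nat \<times> nat + nat \<times> nat) pair_pre_digraph"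
      where H: "H \<in> connected_bipartite_graphs n m"
      "char_coeff 4 H < char_coeff 4 (difference_graph [1, 1] [t, s])" by blast
    from H(1) ts(5) obtain X Y E where "H = bip_graph X Y E" "bipartition X Y E" "bip_connected X Y E"
      "card X + card Y = n" "card E = m" by (rule connected_bipartite_graphsE)
    with bound have "t * s \<le> char_coeff 4 H" by blast
    with H(2) two_row[OF YZ] show False unfolding D by linarith
  qed
  have iso: "digraph_iso (with_proj G) (with_proj (difference_graph [1, 1] [t, s]))"
    if G: "bipartite_optimal n m G" for G :: "'a pair_pre_digraph"
  proof -
    have "G \<in> connected_bipartite_graphs n m"
      using G by (simp add: bipartite_optimal_def is_arg_min_def)
    then obtain X Y E where G_eq: "G = bip_graph X Y E" and part: "bipartition X Y E"
      and con: "bip_connected X Y E" and card: "card X + card Y = n" "card E = m"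
      using ts(5) by (rule connected_bipartite_graphsE)
    interpret bipartition X Y E by (rule part)
    have "card (X \<union> Y) = n" using card_Un_disjoint[OF fin disj] card(1) by simp
    \<comment> \<open>Optimality of \<open>G\<close> only compares graphs over its own vertex type.
      A competitor with value \<open>t * s\<close> is therefore built on the vertices of
      \<open>G\<close>: two arbitrary ones become the rows, the others the columns.\<close>
    then obtain U where U: "U \<subseteq> X \<union> Y" "card U = 2" "finite U"
      using obtain_subset_with_card_n[of 2 "X \<union> Y"] assms(1) by auto
    then obtain u u' where u: "U = {u, u'}" "u \<noteq> u'" by (auto simp: card_2_iff)
    define W where "W = X \<union> Y - U"
    have W: "card W = n - 2" "finite W"
      using U \<open>card (X \<union> Y) = n\<close> fin by (simp_all add: W_def card_Diff_subset)
    then obtain Z where Z: "Z \<subseteq> W" "card Z = t"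
      using obtain_subset_with_card_n[of t W] ts(1) by auto
    have "bip_graph {u, u'} W (two_row u u' W Z) \<in> connected_bipartite_graphs n m \<and>
        char_coeff 4 (bip_graph {u, u'} W (two_row u u' W Z)) = int (t * s)"
      using two_row[of u u' W Z] u W Z by (auto simp: W_def)
    then have "char_coeff 4 G \<le> t * s"
      using G unfolding bipartite_optimal_def is_arg_min_def by (metis linorder_not_less)
    then have "char_coeff 4 G = t * s" 
      using bound[OF part con card] unfolding G_eq by linarith
    then have dom: "dominating_pair X Y E \<or> dominating_pair Y X (E\<inverse>)"
      using bound[OF part con card] unfolding G_eq by blast
    \<comment> \<open>Kept general in the sides, because the dominating pair may lie in
      \<open>X\<close> or in \<open>Y\<close>; exchanging the sides gives the same graph.\<close>
    have iso: "digraph_iso (with_proj (bip_graph X' Y' E')) (with_proj (difference_graph [1, 1] [t, s]))"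
      if h: "dominating_pair X' Y' E'" "bipartition X' Y' E'" "card X' + card Y' = n" "card E' = m"
      for X' Y' :: "'a set" and E'
    proof -
      interpret B: bipartition X' Y' E' by (rule h)
      obtain u u' Z where e: "u \<noteq> u'" "X' = {u, u'}" "Z \<subseteq> Y'" "E' = two_row u u' Y' Z"
        using h(1) B.edges_subset by (rule dominating_pairE)
      have Y': "card Y' = n - 2" using h(3) e(1,2) by simp
      have "card Z = t"
        using h(4) card_two_row[OF e(1) B.fin(2) e(3)] Y' ts(2) e(4) by simp
      then show ?thesis
        unfolding D e(2,4)
        by (intro digraph_iso_two_row) (use e B.disj B.fin YZ Y' in auto)
    qed
    from dom show ?thesis
    proof
      assume "dominating_pair X Y E"
      then show ?thesis unfolding G_eq by (rule iso) (use part card in auto)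
    next
      assume "dominating_pair Y X (E\<inverse>)"
      moreover have "bipartition Y X (E\<inverse>)"
        using fin disj edges_subset by unfold_locales auto
      ultimately have "digraph_iso (with_proj (bip_graph Y X (E\<inverse>)))
          (with_proj (difference_graph [1, 1] [t, s]))"
        using card by (intro iso) auto
      then show ?thesis unfolding G_eq bip_graph_converse .
    qed
  qed
  show ?thesis using opt iso unfolding t_def s_def by blast
qed

end
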